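(* Let $\mu=(\mu_1\ge\cdots\ge\mu_L>0)$ be a partition and let $R=((\mu_1),\dots,(\mu_L))$ be the sequence of its parts regarded as single-rowed partitions. Then $$\mathbb{H}^{\mathrm v}_R[X;t]=\mathbb{B}^{\mathrm v}_R[X;t^2],$$ or equivalently, $K^{\mathrm v}_{\lambda;R}(t)=d_{\lambda R}(t^2)$ for all partitions $\lambda$.
   Context: $\Lambda$ is the ring of symmetric functions in $X=x_1+x_2+\cdots$ (rational coefficients, extended by auxiliary indeterminates as needed), with the scalar product for which Schur functions are orthonormal. Plethystic notation: $P[A]$ is obtained from $P\in\Lambda$ by expressing $P$ in power sums and replacing $p_k$ by $p_k[A]$, where $p_k[A]$ raises every indeterminate in $A$ (including $t$) to the $k$-th power and $p_k[A-B]=p_k[A]-p_k[B]$; $\Omega[A]=\exp(\sum_{k\ge1}p_k[A]/k)$. $P^\perp$ is the operator adjoint to multiplication by $P$ (in the $X$ variables); in particular $\Omega[XA]^\perp P[X]=P[X+A]$. The symbol $\mathrm v$ stands for the vertical domino. Put $f_{\mathrm v}=s_{(1^2)}$, $f_{\mathrm v}[tX]=t^2s_{(1^2)}[X]$, and $s^{\mathrm v}_\lambda=\Omega[-f_{\mathrm v}]^\perp s_\lambda$, a basis of $\Lambda$. Bernstein's operators $B_r\in\mathrm{End}(\Lambda)$ are defined by $\sum_{r\in\mathbb{Z}}B_rz^r=\Omega[zX]\,\Omega[-z^{-1}X]^\perp$ (skew, then multiply), and $B^{\mathrm v}_r=\Omega[-f_{\mathrm v}]^\perp\circ B_r\circ\Omega[f_{\mathrm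 v}]^\perp$. The $t$-analogue of $V\in\mathrm{End}(\Lambda)$ is $\widetilde V(P[X])=V^Y(P[tX+(1-t)Y])|_{Y\to X}$, where $V^Y$ is $V$ acting in a second set of variables $Y$ and afterwards $Y$ is replaced by $X$. Let $\widetilde B_r,\widetilde B^{\mathrm v}_r$ be the $t$-analogues of $B_r,B^{\mathrm v}_r$, let $\widetilde B_{r,t^2}$ be $\widetilde B_r$ with $t$ replaced by $t^2$, and $$H^{\mathrm v}_r=\Omega[f_{\mathrm v}[tX]-f_{\mathrm v}[X]]^\perp\circ\widetilde B_{r,t^2}\circ\Omega[f_{\mathrm v}[X]-f_{\mathrm v}[tX]]^\perp .$$ For $R$ as in the claim, $\mathbb{B}^{\mathrm v}_R[X;t]=\widetilde B^{\mathrm v}_{\mu_1}\cdots\widetilde B^{\mathrm v}_{\mu_L}1=\sum_\lambda d_{\lambda R}(t)s^{\mathrm v}_\lambda$, $\mathbb{B}^{\mathrm v}_R[X;t^2]$ is this with $t\mapsto t^2$, and $\mathbb{H}^{\mathrm v}_R[X;t]=H^{\mathrm v}_{\mu_1}\cdots H^{\mathrm v}_{\mu_L}1=\sum_\lambda K^{\mathrm v}_{\lambda;R}(t)s^{\mathrm v}_\lambda$. *)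

theory Defs
  imports
    "HOL-Library.Poly_Mapping"
    "HOL-Library.Groups_Big_Fun"
    "HOL-Computational_Algebra.Polynomial"
    "HOL-Computational_Algebra.Formal_Power_Series"
    "Jordan_Normal_Form.Determinant"
begin

section \<open>Symmetric functions\<close>

text \<open>
  Over the rationals the ring of symmetric functions in \<open>X = x\<^sub>1 + x\<^sub>2 + \<dots>\<close> is the free commutative
  algebra on the power sums \<open>p\<^sub>1, p\<^sub>2, \<dots>\<close>, and this is how it is represented: an element is a
  polynomial in the power sums. The coefficient ring is \<open>\<rat>[t]\<close>, the type \<open>rat poly\<close>.
  The variable with index \<open>j\<close> (counted from 0) of a monomial stands for \<open>p\<^bsub>j+1\<^esub>\<close>, so that there is
  no \<open>p\<^sub>0\<close>.
\<close>

type_synonym psmonom = "nat \<Rightarrow>\<^sub>0 nat"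
type_synonym symfun = "psmonom \<Rightarrow>\<^sub>0 rat poly"

definition const :: "'c::zero \<Rightarrow> (psmonom \<Rightarrow>\<^sub>0 'c)" where
  "const c = Poly_Mapping.single 0 c"

text \<open>The power sum \<open>p\<^sub>k\<close>; only used for \<open>k \<ge> 1\<close>.\<close>

definition psum :: "nat \<Rightarrow> (psmonom \<Rightarrow>\<^sub>0 'c::zero_neq_one)" where
  "psum k = Poly_Mapping.single (Poly_Mapping.single (k - 1) 1) 1"

definition scale :: "rat poly \<Rightarrow> symfun \<Rightarrow> symfun" where
  "scale c P = const c * P"

definition tvar :: "rat poly" where
  "tvar = [:0, 1:]"

text \<open>\<open>ps_eval \<gamma> \<phi>\<close> maps a coefficient \<open>c\<close> to \<open>\<gamma> c\<close> and replaces every power sum \<open>p\<^sub>k\<close> by \<open>\<phi> k\<close>.\<close>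

definition ps_eval :: "('c::zero \<Rightarrow> 'r::comm_ring_1) \<Rightarrow> (nat \<Rightarrow> 'r) \<Rightarrow> (psmonom \<Rightarrow>\<^sub>0 'c) \<Rightarrow> 'r" where
  "ps_eval \<gamma> \<phi> P =
     (\<Sum>m\<in>Poly_Mapping.keys P. \<gamma> (Poly_Mapping.lookup P m) *
        (\<Prod>j\<in>Poly_Mapping.keys m. \<phi> (Suc j) ^ Poly_Mapping.lookup m j))"


section \<open>Plethysm\<close>

text \<open>\<open>coeff_adams k c\<close> is \<open>c(t\<^sup>k)\<close>, and \<open>adams k A\<close> is \<open>p\<^sub>k[A]\<close>: since \<open>p\<^sub>j\<close> is the sum of the
  \<open>j\<close>-th powers of the indeterminates \<open>x\<^sub>i\<close>, raising these to the \<open>k\<close>-th power turns it into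
  \<open>p\<^bsub>kj\<^esub>\<close>.\<close>

definition coeff_adams :: "nat \<Rightarrow> rat poly \<Rightarrow> rat poly" where
  "coeff_adams k c = pcompose c (monom 1 k)"

definition adams :: "nat \<Rightarrow> symfun \<Rightarrow> symfun" where
  "adams k = ps_eval (\<lambda>c. const (coeff_adams k c)) (\<lambda>j. psum (k * j))"

text \<open>\<open>P[A]\<close>; the coefficients of \<open>P\<close> itself are left unchanged.\<close>

definition plethysm :: "symfun \<Rightarrow> symfun \<Rightarrow> symfun" where
  "plethysm P A = ps_eval const (\<lambda>k. adams k A) P"

text \<open>\<open>X = p\<^sub>1\<close> as a symmetric function.\<close>

definition alphX :: symfun where
  "alphX = psum 1"

text \<open>
  \<open>Omega A\<close> is \<open>\<Omega>[zA] = exp (\<Sum>\<^bsub>k\<ge>1\<^esub> z\<^sup>k p\<^sub>k[A] / k)\<close> as a formal power series in an auxiliary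
  indeterminate \<open>z\<close>. In particular \<open>Omega alphX\<close> and \<open>Omega (- alphX)\<close>, the latter read as a series
  in \<open>z\<^sup>-\<^sup>1\<close>, are the series \<open>\<Omega>[zX]\<close> and \<open>\<Omega>[-z\<^sup>-\<^sup>1X]\<close>.
\<close>

definition Omega :: "symfun \<Rightarrow> symfun fps" where
  "Omega A = fps_compose (Abs_fps (\<lambda>n. const [:1 / of_nat (fact n):]))
     (Abs_fps (\<lambda>k. if k = 0 then 0 else const [:1 / of_nat k:] * adams k A))"


section \<open>Schur functions and the scalar product\<close>

definition is_partition :: "nat list \<Rightarrow> bool" where
  "is_partition \<nu> \<longleftrightarrow> sorted_wrt (\<ge>) \<nu> \<and> (\<forall>i\<in>set \<nu>. 0 < i)"

text \<open>Complete homogeneous symmetric functions: \<open>\<Omega>[zX] = \<Sum>\<^sub>n h\<^sub>n z\<^sup>n\<close>, and \<open>h\<^sub>n = 0\<close> for \<open>n < 0\<close>.\<close>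

definition hsym :: "int \<Rightarrow> symfun" where
  "hsym n = (if n < 0 then 0 else fps_nth (Omega alphX) (nat n))"

text \<open>Schur functions, by the Jacobi--Trudi determinant.\<close>

definition schur :: "nat list \<Rightarrow> symfun" where
  "schur \<nu> = det (mat (length \<nu>) (length \<nu>) (\<lambda>(i, j). hsym (int (\<nu> ! i) - int i + int j)))"

text \<open>The \<open>\<rat>[t]\<close>-bilinear scalar product for which the Schur functions are orthonormal.\<close>

definition hall :: "symfun \<Rightarrow> symfun \<Rightarrow> rat poly" where
  "hall = (THE b.
     (\<forall>Q. module_hom scale (*) (\<lambda>P. b P Q)) \<and>
     (\<forall>P. module_hom scale (*) (\<lambda>Q. b P Q)) \<and>
     (\<forall>\<nu> \<mu>. is_partition \<nu> \<longrightarrow> is_partition \<mu> \<longrightarrow>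
        b (schur \<nu>) (schur \<mu>) = (if \<nu> = \<mu> then 1 else 0)))"

text \<open>\<open>perp F\<close> is \<open>F\<^sup>\<bottom>\<close>, the adjoint of multiplication by \<open>F\<close>.\<close>

definition perp :: "symfun \<Rightarrow> symfun \<Rightarrow> symfun" where
  "perp F P = (THE P'. \<forall>Q. hall P' Q = hall P (F * Q))"

text \<open>
  \<open>Omega_perp A\<close> is \<open>\<Omega>[A]\<^sup>\<bottom>\<close> for \<open>A\<close> without constant term. The element \<open>\<Omega>[A]\<close> lies in the
  completion; it is the sum of the coefficients of \<open>\<Omega>[zA]\<close>, of which only finitely many have
  a nonzero adjoint action on a given symmetric function.
\<close>

definition Omega_perp :: "symfun \<Rightarrow> symfun \<Rightarrow> symfun" where
  "Omega_perp A P = Sum_any (\<lambda>n. perp (fps_nth (Omega A) n) P)"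

text \<open>
  The coefficients of \<open>P\<close> with respect to a \<open>\<rat>[t]\<close>-basis of the symmetric functions that is
  indexed by partitions.
\<close>

definition basis_coeffs :: "(nat list \<Rightarrow> symfun) \<Rightarrow> symfun \<Rightarrow> nat list \<Rightarrow> rat poly" where
  "basis_coeffs b P = (THE c.
     finite {\<nu>. c \<nu> \<noteq> 0} \<and> {\<nu>. c \<nu> \<noteq> 0} \<subseteq> Collect is_partition \<and>
     P = (\<Sum>\<nu> | c \<nu> \<noteq> 0. scale (c \<nu>) (b \<nu>)))"


section \<open>The \<open>t\<close>-analogue of an operator\<close>

text \<open>
  Symmetric functions in two sets of variables \<open>X\<close>, \<open>Y\<close> are polynomials in the power sums
  \<open>p\<^sub>k[Y]\<close> with coefficients in the symmetric functions of \<open>X\<close>.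
\<close>

type_synonym symfun2 = "psmonom \<Rightarrow>\<^sub>0 symfun"

definition inX :: "symfun \<Rightarrow> symfun2" where
  "inX P = const P"

definition inY :: "symfun \<Rightarrow> symfun2" where
  "inY = ps_eval (\<lambda>c. inX (const c)) psum"

text \<open>\<open>P[cX + (1 - c)Y]\<close> for \<open>c \<in> \<rat>[t]\<close>, using
  \<open>p\<^sub>k[cX + (1 - c)Y] = c(t\<^sup>k) p\<^sub>k[X] + (1 - c(t\<^sup>k)) p\<^sub>k[Y]\<close>.\<close>

definition mixXY :: "rat poly \<Rightarrow> symfun \<Rightarrow> symfun2" where
  "mixXY c = ps_eval (\<lambda>a. inX (const a))
     (\<lambda>k. inX (scale (coeff_adams k c) (psum k)) + inY (scale (1 - coeff_adams k c) (psum k)))"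

text \<open>\<open>V\<^sup>Y\<close> for a \<open>\<rat>[t]\<close>-linear operator \<open>V\<close>: \<open>p\<^sub>m[Y]\<close> becomes \<open>(V p\<^sub>m)[Y]\<close> for every power sum
  product \<open>p\<^sub>m\<close>, and functions of \<open>X\<close> are scalars.\<close>

definition actY :: "(symfun \<Rightarrow> symfun) \<Rightarrow> symfun2 \<Rightarrow> symfun2" where
  "actY V Q = (\<Sum>m\<in>Poly_Mapping.keys Q.
     inX (Poly_Mapping.lookup Q m) * inY (V (Poly_Mapping.single m 1)))"

definition Y_to_X :: "symfun2 \<Rightarrow> symfun" where
  "Y_to_X = ps_eval (\<lambda>P. P) psum"

text \<open>The \<open>t\<close>-analogue of \<open>V\<close>, with \<open>c\<close> in the place of \<open>t\<close>.\<close>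

definition analogue :: "rat poly \<Rightarrow> (symfun \<Rightarrow> symfun) \<Rightarrow> symfun \<Rightarrow> symfun" where
  "analogue c V P = Y_to_X (actY V (mixXY c P))"


section \<open>Creation operators for the vertical domino\<close>

definition fv :: symfun where
  "fv = schur [1, 1]"

definition fv_t :: symfun where
  "fv_t = plethysm fv (scale tvar alphX)"

definition schur_v :: "nat list \<Rightarrow> symfun" where
  "schur_v \<nu> = Omega_perp (- fv) (schur \<nu>)"

text \<open>\<open>bernstein r\<close> is the coefficient of \<open>z\<^sup>r\<close> in \<open>\<Omega>[zX] \<Omega>[-z\<^sup>-\<^sup>1X]\<^sup>\<bottom>\<close>: the coefficients of
  \<open>z\<^bsup>r+m\<^esup>\<close> and of \<open>z\<^bsup>-m\<^esup>\<close> in the two factors contribute, for all \<open>m \<ge> 0\<close> with \<open>r + m \<ge> 0\<close>.\<close>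

definition bernstein :: "int \<Rightarrow> symfun \<Rightarrow> symfun" where
  "bernstein r P = Sum_any (\<lambda>m::nat. if r + int m < 0 then 0
     else fps_nth (Omega alphX) (nat (r + int m)) * perp (fps_nth (Omega (- alphX)) m) P)"

definition bernstein_v :: "int \<Rightarrow> symfun \<Rightarrow> symfun" where
  "bernstein_v r = Omega_perp (- fv) \<circ> bernstein r \<circ> Omega_perp fv"

definition H_op :: "int \<Rightarrow> symfun \<Rightarrow> symfun" where
  "H_op r = Omega_perp (fv_t - fv) \<circ> analogue (tvar\<^sup>2) (bernstein r) \<circ> Omega_perp (fv - fv_t)"

text \<open>
  In the remaining definitions the list \<open>\<mu>\<close> represents the sequence \<open>R = ((\<mu>\<^sub>1), \<dots>, (\<mu>\<^sub>L))\<close> of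
  single-rowed partitions. The two symmetric functions are
  \<open>\<bbbB>\<^sup>v\<^sub>R[X;t]\<close> and \<open>\<bbbH>\<^sup>v\<^sub>R[X;t]\<close>, and \<open>d_coeff\<close> and \<open>K_coeff\<close> are their coefficients
  \<open>d\<^bsub>\<nu>R\<^esub>(t)\<close> and \<open>K\<^sup>v\<^bsub>\<nu>;R\<^esub>(t)\<close>.
\<close>

definition BB :: "nat list \<Rightarrow> symfun" where
  "BB \<mu> = foldr (\<lambda>r. analogue tvar (bernstein_v (int r))) \<mu> 1"

definition HH :: "nat list \<Rightarrow> symfun" where
  "HH \<mu> = foldr (\<lambda>r. H_op (int r)) \<mu> 1"

definition d_coeff :: "nat list \<Rightarrow> nat list \<Rightarrow> rat poly" where
  "d_coeff \<nu> \<mu> = basis_coeffs schur_v (BB \<mu>) \<nu>"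

definition K_coeff :: "nat list \<Rightarrow> nat list \<Rightarrow> rat poly" where
  "K_coeff \<nu> \<mu> = basis_coeffs schur_v (HH \<mu>) \<nu>"

text \<open>The substitution \<open>t \<mapsto> t\<^sup>2\<close> in the coefficients; unlike in \<open>adams 2\<close>, the power sums stay.\<close>

definition t_to_t2 :: "symfun \<Rightarrow> symfun" where
  "t_to_t2 = Poly_Mapping.map (\<lambda>c. pcompose c (tvar\<^sup>2))"

end

theory Submission
  imports Defs
begin

text \<open>
  Both sides are iterated creation operators, and the two operators agree. Skewing by
  \<open>\<Omega>[zX]\<close>-type series substitutes in the power sums, so that
  \<open>\<Omega>[zX] \<Omega>[azX]\<^sup>\<bottom> \<Omega>[-bz\<^sup>-\<^sup>1X]\<^sup>\<bottom>\<close> sends \<open>P[X]\<close> to \<open>\<Omega>[zX] P[X + az - bz\<^sup>-\<^sup>1]\<close>; call its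
  parameters \<open>(a, b)\<close>. The Bernstein operators have parameters \<open>(0, 1)\<close>. Since \<open>f\<^sub>v = e\<^sub>2\<close>
  satisfies \<open>f\<^sub>v[X + z] = f\<^sub>v[X] + zX\<close>, conjugation by \<open>\<Omega>[c f\<^sub>v]\<^sup>\<bottom>\<close> changes \<open>(0, b)\<close> into
  \<open>(c, b)\<close>, and the \<open>t\<close>-analogue multiplies both parameters by \<open>1 - t\<close>. Hence the operators on
  one side have parameters \<open>(-(1 - t), 1 - t)\<close> and, because \<open>f\<^sub>v[tX] = t\<^sup>2 f\<^sub>v\<close>, those on the
  other side have \<open>(t\<^sup>2 - 1, 1 - t\<^sup>2)\<close>. The scalar product, which is characterised by
  orthonormality of the Schur functions, is computed in the power sum basis.
\<close>

text \<open>Two-sided series in z are never formed: an operator family is pinned down by its value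
  at 1 and by its commutators with multiplication by the power sums, so families are compared by
  induction over power sum products. The order of the constructions explains the constants. On one
  side conjugation by -f_v inserts -1 as first parameter, which the analogue then multiplies by 1 -
  t; on the other side the analogue comes first, so the conjugation by (t^2 - 1) f_v has to insert
  the scaled value itself. Most of the work is forced by the scalar product, which is given only
  through its values on Jacobi-Trudi determinants and must be shown to exist and to be unique.
  Bernstein operators achieve both. They add a row to a Schur function; their relations with skewing
  by h_a give orthonormality in the power sum form, and writing multiplication by h_r through them
  shows that Schur functions span.\<close>

text \<open>Stated for arbitrary keys and values, since it serves for symmetric functions, for
  functions in two alphabets and for the exponent vectors themselves.\<close>

lemma poly_mapping_additive_induct [case_names single add]:
  fixes P :: "'a \<Rightarrow>\<^sub>0 'b::comm_monoid_add"
  assumes "\<And>m c. X (Poly_Mapping.single m c)" and "\<And>P Q. X P \<Longrightarrow> X Q \<Longrightarrow> X (P + Q)"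
  shows "X P"
proof (induction P rule: measure_induct_rule[of "\<lambda>P. card (Poly_Mapping.keys P)"])
  case (less P)
  show ?case
  proof (cases "P = 0")
    case True
    \<comment> \<open>The zero mapping counts as a single term with coefficient 0 at an arbitrary
      key.\<close>
    then show ?thesis using assms(1)[of undefined 0] by simp
  next
    case False
    then obtain k where k: "k \<in> Poly_Mapping.keys P"
      by (metis ex_in_conv keys_eq_empty)
    define Q where "Q = Poly_Mapping.update k 0 P"
    have "Poly_Mapping.keys Q = Poly_Mapping.keys P - {k}"
      unfolding Q_def by (simp add: keys_update)
    then have "card (Poly_Mapping.keys Q) < card (Poly_Mapping.keys P)"
      using k by (metis card_Diff1_less finite_keys)
    then have "X Q" by (rule less)
    moreover have "P = Q + Poly_Mapping.single k (Poly_Mapping.lookup P k)"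
      unfolding Q_def
      by (intro poly_mapping_eqI) (auto simp: lookup_add lookup_update lookup_single when_def)
    ultimately show ?thesis using assms by metis
  qed
qed

lemma single_psum_mult:
  "psum (Suc j) * Poly_Mapping.single m c = Poly_Mapping.single (Poly_Mapping.single j 1 + m) (c::'c::comm_ring_1)"
  by (simp add: psum_def mult_single)

lemma const_mult_single: "const a * Poly_Mapping.single m c = Poly_Mapping.single m (a * c::'c::comm_ring_1)"
  by (simp add: const_def mult_single)

text \<open>The induction suited to operators known through their commutators with power sums: the
  step strips one factor \<open>p\<^sub>n\<close>.\<close>

lemma psum_induct [case_names const psum add]:
  fixes P :: "psmonom \<Rightarrow>\<^sub>0 'c::comm_ring_1"
  assumes const: "\<And>c. X (const c)"
    and psum: "\<And>n P. n > 0 \<Longrightarrow> X P \<Longrightarrow> X (psum n * P)"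
    and add: "\<And>P Q. X P \<Longrightarrow> X Q \<Longrightarrow> X (P + Q)"
  shows "X P"
proof (induction P rule: poly_mapping_additive_induct)
  case (single m c)
  have pow: "X Q \<Longrightarrow> X (Poly_Mapping.single (Poly_Mapping.single j i) 1 * Q)" for Q and j i :: nat
  proof (induction i)
    case (Suc i)
    have "Poly_Mapping.single (Poly_Mapping.single j (Suc i)) 1 =
       psum (Suc j) * Poly_Mapping.single (Poly_Mapping.single j i) (1::'c)"
      by (simp add: single_psum_mult flip: single_add)
    then show ?case using psum[of "Suc j"] Suc by (simp add: mult.assoc)
  qed simp
  have "X Q \<Longrightarrow> X (Poly_Mapping.single m 1 * Q)" for Q
  proof (induction m arbitrary: Q rule: poly_mapping_additive_induct)
    case (single j i)
    then show ?case by (rule pow)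
  next
    case (add m m')
    then have "X (Poly_Mapping.single m 1 * (Poly_Mapping.single m' 1 * Q))" by blast
    then show ?case by (simp add: mult_single flip: mult.assoc)
  qed
  from this[OF const[of c]] show ?case by (simp add: const_def mult_single)
next
  case (add P Q)
  then show ?case by (rule assms(3))
qed

section \<open>Evaluation homomorphisms\<close>

lemma const_add: "const (a + b) = const a + const b"
  by (simp add: const_def single_add)

lemma const_mult: "const (a * b :: 'c::comm_ring_1) = const a * const b"
  by (simp add: const_def mult_single)

lemma const_0 [simp]: "const 0 = 0"
  by (simp add: const_def)

lemma const_1 [simp]: "const (1 :: 'c::comm_ring_1) = 1"
  by (simp add: const_def)

lemma const_uminus: "const (- a :: 'c::comm_ring_1) = - const a"
  by (simp add: const_def single_uminus)

lemma const_diff: "const (a - b :: 'c::comm_ring_1) = const a - const b"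
  by (simp add: const_def single_diff)

lemma const_of_nat [simp]: "const (of_nat n :: 'c::comm_ring_1) = of_nat n"
  by (simp add: const_def)

lemma comm_ring_hom_const: "comm_ring_hom (const :: 'c::comm_ring_1 \<Rightarrow> _)"
  by unfold_locales (simp_all add: const_add const_mult)

definition monom_val :: "(nat \<Rightarrow> 'r::comm_ring_1) \<Rightarrow> psmonom \<Rightarrow> 'r" where
  "monom_val \<phi> m = (\<Prod>j\<in>Poly_Mapping.keys m. \<phi> (Suc j) ^ Poly_Mapping.lookup m j)"

lemma monom_val_superset:
  assumes "finite K" "Poly_Mapping.keys m \<subseteq> K"
  shows "monom_val \<phi> m = (\<Prod>j\<in>K. \<phi> (Suc j) ^ Poly_Mapping.lookup m j)"
  unfolding monom_val_def using assms
  by (intro prod.mono_neutral_left) (auto simp: in_keys_iff)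

lemma monom_val_add: "monom_val \<phi> (m + l) = monom_val \<phi> m * monom_val \<phi> l"
proof -
  let ?K = "Poly_Mapping.keys m \<union> Poly_Mapping.keys l"
  show ?thesis
    using keys_add[of m l]
    by (simp add: monom_val_superset[of ?K] lookup_add power_add prod.distrib)
qed

lemma monom_val_0 [simp]: "monom_val \<phi> 0 = 1"
  by (simp add: monom_val_def)

lemma monom_val_single [simp]: "monom_val \<phi> (Poly_Mapping.single j i) = \<phi> (Suc j) ^ i"
  by (subst monom_val_superset[of "{j}"]) (auto simp: lookup_single when_def split: if_splits)

text \<open>Cancellation may shrink the support of \<open>P + Q\<close>, but
  \<open>f m 0 = 0\<close> makes surplus keys harmless. Operators defined by sums over keys obtain
  their additivity here.\<close>

lemma keys_sum_additive:
  fixes f :: "'a \<Rightarrow> 'b::comm_monoid_add \<Rightarrow> 'r::comm_monoid_add"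
  assumes "\<And>m. f m 0 = 0" and "\<And>m a b. f m (a + b) = f m a + f m b"
  shows "(\<Sum>m\<in>Poly_Mapping.keys (P + Q). f m (Poly_Mapping.lookup (P + Q) m)) =
    (\<Sum>m\<in>Poly_Mapping.keys P. f m (Poly_Mapping.lookup P m)) +
    (\<Sum>m\<in>Poly_Mapping.keys Q. f m (Poly_Mapping.lookup Q m))"
  using assms by (rule setsum_keys_plus_distrib)

lemma keys_sum_single:
  fixes f :: "'a \<Rightarrow> 'b::comm_monoid_add \<Rightarrow> 'r::comm_monoid_add"
  assumes "\<And>m. f m 0 = 0"
  shows "(\<Sum>m\<in>Poly_Mapping.keys (Poly_Mapping.single k c). f m (Poly_Mapping.lookup (Poly_Mapping.single k c) m)) = f k c"
  using assms by (cases "c = 0") auto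

context
  fixes \<gamma> :: "'c::comm_ring_1 \<Rightarrow> 'r::comm_ring_1"
  assumes hom: "comm_ring_hom \<gamma>"
begin

interpretation comm_ring_hom \<gamma> by (rule hom)

lemma ps_eval_single: "ps_eval \<gamma> \<phi> (Poly_Mapping.single m c) = \<gamma> c * monom_val \<phi> m"
  unfolding ps_eval_def monom_val_def[symmetric]
  by (subst keys_sum_single[of "\<lambda>m a. \<gamma> a * monom_val \<phi> m"]) auto

lemma ps_eval_add: "ps_eval \<gamma> \<phi> (P + Q) = ps_eval \<gamma> \<phi> P + ps_eval \<gamma> \<phi> Q"
  unfolding ps_eval_def monom_val_def[symmetric]
  by (rule keys_sum_additive[of "\<lambda>m a. \<gamma> a * monom_val \<phi> m"]) (auto simp: hom_add distrib_right)

lemma ps_eval_mult: "ps_eval \<gamma> \<phi> (P * Q) = ps_eval \<gamma> \<phi> P * ps_eval \<gamma> \<phi> Q"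
proof (induction P rule: poly_mapping_additive_induct)
  case (single m c)
  show ?case
    by (induction Q rule: poly_mapping_additive_induct)
      (simp_all add: mult_single ps_eval_single hom_mult monom_val_add ps_eval_add algebra_simps)
next
  case (add P Q')
  then show ?case by (simp add: distrib_right ps_eval_add)
qed

lemma ps_eval_const: "ps_eval \<gamma> \<phi> (const c) = \<gamma> c"
  by (simp add: const_def ps_eval_single)

lemma ps_eval_psum: "n > 0 \<Longrightarrow> ps_eval \<gamma> \<phi> (psum n) = \<phi> n"
  by (simp add: psum_def ps_eval_single)

lemma comm_ring_hom_ps_eval: "comm_ring_hom (ps_eval \<gamma> \<phi>)"
proof
  show "ps_eval \<gamma> \<phi> 1 = 1" using ps_eval_const[of \<phi> 1] by simp
  show "ps_eval \<gamma> \<phi> 0 = 0" by (simp add: ps_eval_def)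
qed (simp_all add: ps_eval_add ps_eval_mult)

end

section \<open>The derivations adjoint to the power sums\<close>

text \<open>This is n times the partial derivative in \<open>p\<^sub>n\<close>. Exponents are
  subtracted with truncation, but the coefficient vanishes wherever \<open>p\<^sub>n\<close> does
  not occur.\<close>

definition pdiff :: "nat \<Rightarrow> symfun \<Rightarrow> symfun" where
  "pdiff n P = (\<Sum>m\<in>Poly_Mapping.keys P. Poly_Mapping.single (m - Poly_Mapping.single (n - 1) 1)
     (of_nat (n * Poly_Mapping.lookup m (n - 1)) * Poly_Mapping.lookup P m))"

lemma pdiff_single: "pdiff n (Poly_Mapping.single m c) =
    Poly_Mapping.single (m - Poly_Mapping.single (n - 1) 1) (of_nat (n * Poly_Mapping.lookup m (n - 1)) * c)"
  unfolding pdiff_def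
  by (rule keys_sum_single[of "\<lambda>m a. Poly_Mapping.single (m - Poly_Mapping.single (n - 1) 1)
     (of_nat (n * Poly_Mapping.lookup m (n - 1)) * a)"]) simp

lemma pdiff_add: "pdiff n (P + Q) = pdiff n P + pdiff n Q"
  unfolding pdiff_def
  by (rule keys_sum_additive[of "\<lambda>m a. Poly_Mapping.single (m - Poly_Mapping.single (n - 1) 1)
     (of_nat (n * Poly_Mapping.lookup m (n - 1)) * a)"]) (simp_all add: distrib_left single_add)

lemma minus_single_add:
  fixes m l :: psmonom
  assumes "Poly_Mapping.lookup m k > 0"
  shows "m + l - Poly_Mapping.single k 1 = (m - Poly_Mapping.single k 1) + l"
  using assms
  by (intro poly_mapping_eqI) (auto simp: lookup_add lookup_minus lookup_single when_def)

lemma pdiff_single_mult_single: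
  "pdiff n (Poly_Mapping.single m a * Poly_Mapping.single l b) =
   pdiff n (Poly_Mapping.single m a) * Poly_Mapping.single l b +
   Poly_Mapping.single m a * pdiff n (Poly_Mapping.single l b)"
proof -
  let ?e = "Poly_Mapping.single (n - 1) 1 :: psmonom"
  let ?m = "Poly_Mapping.lookup m (n - 1)" and ?l = "Poly_Mapping.lookup l (n - 1)"
  \<comment> \<open>With exponent 0 the truncated differences may disagree; both sides are then
    0.\<close>
  have 1: "Poly_Mapping.single (m + l - ?e) (of_nat (n * ?m) * (a * b)) =
      Poly_Mapping.single (m - ?e + l) (of_nat (n * ?m) * (a * b))"
    by (cases "?m = 0") (simp_all add: minus_single_add[of m, unfolded One_nat_def])
  have 2: "Poly_Mapping.single (m + l - ?e) (of_nat (n * ?l) * (a * b)) =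
      Poly_Mapping.single (m + (l - ?e)) (of_nat (n * ?l) * (a * b))"
    by (cases "?l = 0") (simp_all add: minus_single_add[of l _ m, unfolded One_nat_def] add.commute[of m])
  have "pdiff n (Poly_Mapping.single m a * Poly_Mapping.single l b) =
     Poly_Mapping.single (m + l - ?e) (of_nat (n * ?m) * (a * b)) +
     Poly_Mapping.single (m + l - ?e) (of_nat (n * ?l) * (a * b))"
    by (simp add: mult_single pdiff_single lookup_add algebra_simps flip: single_add)
  also have "\<dots> = pdiff n (Poly_Mapping.single m a) * Poly_Mapping.single l b +
     Poly_Mapping.single m a * pdiff n (Poly_Mapping.single l b)"
    unfolding 1 2 by (simp add: mult_single pdiff_single algebra_simps)
  finally show ?thesis .
qed

lemma pdiff_mult: "pdiff n (P * Q) = pdiff n P * Q + P * pdiff n Q"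
proof (induction P rule: poly_mapping_additive_induct)
  case (single m a)
  show ?case
    by (induction Q rule: poly_mapping_additive_induct)
      (simp_all add: pdiff_single_mult_single pdiff_add algebra_simps)
next
  case (add P P')
  then show ?case by (simp add: pdiff_add algebra_simps)
qed

lemma pdiff_const [simp]: "pdiff n (const c) = 0"
  by (simp add: const_def pdiff_single)

lemma pdiff_0 [simp]: "pdiff n 0 = 0"
  by (simp add: pdiff_def)

lemma pdiff_scale: "pdiff n (const c * P) = const c * pdiff n P"
  by (simp add: pdiff_mult)

lemma pdiff_uminus: "pdiff n (- P) = - pdiff n P"
  using pdiff_add[of n P "- P"] by (simp add: eq_neg_iff_add_eq_0 add.commute)

lemma pdiff_diff: "pdiff n (P - Q) = pdiff n P - pdiff n Q"
  using pdiff_add[of n P "- Q"] by (simp add: pdiff_uminus)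

lemma pdiff_sum: "pdiff n (\<Sum>i\<in>I. f i) = (\<Sum>i\<in>I. pdiff n (f i))"
  by (induction I rule: infinite_finite_induct) (simp_all add: pdiff_add)

lemma pdiff_psum:
  assumes "n > 0" "k > 0"
  shows "pdiff n (psum k) = (if n = k then of_nat n else 0)"
  using assms by (auto simp: psum_def pdiff_single lookup_single when_def)

section \<open>The power sum form\<close>

text \<open>The classical \<open>z\<^sub>\<lambda>\<close>, the Hall norm of a power sum
  product.\<close>

definition zcoef :: "psmonom \<Rightarrow> rat poly" where
  "zcoef m = (\<Prod>j\<in>Poly_Mapping.keys m. of_nat (Suc j ^ Poly_Mapping.lookup m j * fact (Poly_Mapping.lookup m j)))"

definition form :: "symfun \<Rightarrow> symfun \<Rightarrow> rat poly" where
  "form P Q = (\<Sum>m\<in>Poly_Mapping.keys P. Poly_Mapping.lookup P m * (Poly_Mapping.lookup Q m * zcoef m))"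

lemma zcoef_nonzero: "zcoef m \<noteq> 0"
  unfolding zcoef_def by (simp del: of_nat_mult of_nat_power of_nat_Suc)

lemma zcoef_superset:
  assumes "finite K" "Poly_Mapping.keys m \<subseteq> K"
  shows "zcoef m = (\<Prod>j\<in>K. of_nat (Suc j ^ Poly_Mapping.lookup m j * fact (Poly_Mapping.lookup m j)))"
  unfolding zcoef_def using assms
  by (intro prod.mono_neutral_left) (auto simp: in_keys_iff)

lemma zcoef_0 [simp]: "zcoef 0 = 1"
  by (simp add: zcoef_def)

lemma zcoef_add_single:
  "zcoef (m + Poly_Mapping.single k 1) = of_nat (Suc k * Suc (Poly_Mapping.lookup m k)) * zcoef m"
proof -
  define K where "K = insert k (Poly_Mapping.keys m)"
  let ?f = "\<lambda>m j. of_nat (Suc j ^ Poly_Mapping.lookup m j * fact (Poly_Mapping.lookup m j)) :: rat poly"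
  have K: "finite K" "k \<in> K" by (auto simp: K_def)
  have "Poly_Mapping.keys (m + Poly_Mapping.single k 1) \<subseteq> K"
    using keys_add[of m "Poly_Mapping.single k 1"] by (auto simp: K_def)
  then have "zcoef (m + Poly_Mapping.single k 1) = prod (?f (m + Poly_Mapping.single k 1)) K"
    by (rule zcoef_superset[OF K(1)])
  also have "\<dots> = ?f (m + Poly_Mapping.single k 1) k * prod (?f m) (K - {k})"
    using K by (subst prod.remove[of K k]) (auto simp: lookup_add lookup_single intro!: prod.cong)
  also have "?f (m + Poly_Mapping.single k 1) k = of_nat (Suc k * Suc (Poly_Mapping.lookup m k)) * ?f m k"
    by (simp add: lookup_add algebra_simps)
  also have "of_nat (Suc k * Suc (Poly_Mapping.lookup m k)) * ?f m k * prod (?f m) (K - {k}) =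
    of_nat (Suc k * Suc (Poly_Mapping.lookup m k)) * prod (?f m) K"
    using K by (subst prod.remove[of K k]) (auto simp: mult.assoc)
  also have "prod (?f m) K = zcoef m"
    by (rule zcoef_superset[symmetric]) (auto simp: K_def)
  finally show ?thesis .
qed

lemma form_add_left: "form (P + P') Q = form P Q + form P' Q"
  unfolding form_def
  by (rule keys_sum_additive[of "\<lambda>m a. a * (Poly_Mapping.lookup Q m * zcoef m)"]) (simp_all add: distrib_right)

lemma form_add_right: "form P (Q + Q') = form P Q + form P Q'"
  by (simp add: form_def lookup_add algebra_simps sum.distrib)

lemma form_single_left: "form (Poly_Mapping.single m a) Q = a * (Poly_Mapping.lookup Q m * zcoef m)"
  unfolding form_def
  by (rule keys_sum_single[of "\<lambda>m a. a * (Poly_Mapping.lookup Q m * zcoef m)"]) simp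

lemma form_commute: "form P Q = form Q P"
proof (induction P rule: poly_mapping_additive_induct)
  case (single m a)
  show ?case
    by (induction Q rule: poly_mapping_additive_induct)
      (auto simp: form_single_left lookup_single when_def form_add_right form_add_left)
qed (simp_all add: form_add_left form_add_right)

lemma lookup_const_mult: "Poly_Mapping.lookup (const c * P) m = c * Poly_Mapping.lookup (P::psmonom \<Rightarrow>\<^sub>0 'c::comm_ring_1) m"
  by (induction P rule: poly_mapping_additive_induct)
    (auto simp: const_def mult_single lookup_single when_def lookup_add algebra_simps)

lemma form_scale_right: "form P (const c * Q) = c * form P Q"
  by (simp add: form_def lookup_const_mult sum_distrib_left mult.left_commute mult.assoc)

lemma form_scale_left: "form (const c * P) Q = c * form P Q"
  by (simp add: form_commute[of _ Q] form_scale_right)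

text \<open>Pairing with a monomial isolates one coefficient times its \<open>zcoef\<close>, which
  is nonzero and cancels in the domain of coefficients.\<close>

lemma form_eqI:
  assumes "\<And>Q. form P Q = form P' Q"
  shows "P = P'"
proof (rule poly_mapping_eqI)
  fix m
  have "form (Poly_Mapping.single m 1) P = form (Poly_Mapping.single m 1) P'"
    using assms[of "Poly_Mapping.single m 1"] by (simp add: form_commute)
  then show "Poly_Mapping.lookup P m = Poly_Mapping.lookup P' m"
    by (simp add: form_single_left zcoef_nonzero)
qed

text \<open>By \<open>zcoef_add_single\<close> a further factor \<open>p\<^sub>n\<close> multiplies
  the norm by n times the new exponent, which is exactly the factor produced by
  \<open>pdiff n\<close>.\<close>

lemma form_psum_mult:
  assumes "n > 0"
  shows "form (psum n * P) Q = form P (pdiff n Q)"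
proof (induction P rule: poly_mapping_additive_induct)
  case (single m a)
  obtain k where n: "n = Suc k" using assms by (cases n) auto
  let ?e = "Poly_Mapping.single k 1 :: psmonom"
  show ?case
  proof (induction Q rule: poly_mapping_additive_induct)
    case (single l b)
    \<comment> \<open>Truncated subtraction also admits l = m without any \<open>p\<^sub>n\<close>;
      the second premise excludes it, and the coefficient of the derivative is 0 there.\<close>
    have 1: "l = ?e + m" if "l - ?e = m" "Poly_Mapping.lookup l k \<noteq> 0"
      using that by (intro poly_mapping_eqI) (auto simp: lookup_add lookup_minus lookup_single when_def)
    have "form (psum n * Poly_Mapping.single m a) (Poly_Mapping.single l b) =
       (if l = ?e + m then a * (b * zcoef l) else 0)"
      by (auto simp: n single_psum_mult form_single_left lookup_single when_def)
    moreover have "form (Poly_Mapping.single m a) (pdiff n (Poly_Mapping.single l b)) =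
       (if l - ?e = m then a * (of_nat (n * Poly_Mapping.lookup l k) * b * zcoef m) else 0)"
      by (auto simp: n pdiff_single form_single_left lookup_single when_def)
    moreover have "zcoef l = of_nat (n * Poly_Mapping.lookup l k) * zcoef m" if "l = ?e + m"
      using zcoef_add_single[of m k] unfolding that n by (simp add: add.commute[of m] lookup_add)
    moreover have "l - ?e = m" "Poly_Mapping.lookup l k \<noteq> 0" if "l = ?e + m"
      using that by (simp_all add: lookup_add)
    ultimately show ?case
      using 1 by (cases "l = ?e + m") (auto simp: mult.assoc mult.left_commute[of b])
  qed (simp_all add: form_add_right pdiff_add)
qed (simp_all add: form_add_left distrib_left)

section \<open>Adjoints\<close>

text \<open>\<open>perp\<close> with \<open>form\<close> in the place of \<open>hall\<close>; the
  two are identified after \<open>hall_eq_form\<close>.\<close>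

definition padj :: "symfun \<Rightarrow> symfun \<Rightarrow> symfun" where
  "padj F P = (THE P'. \<forall>Q. form P' Q = form P (F * Q))"

text \<open>Existence is constructive: constants are self-adjoint, \<open>psum n\<close> has adjoint
  \<open>pdiff n\<close>, and adjoints compose and add. Nondegeneracy gives uniqueness.\<close>

lemma form_padj: "form (padj F P) Q = form P (F * Q)"
proof -
  have "\<exists>P'. \<forall>Q. form P' Q = form P (F * Q)" for P
  proof (induction F arbitrary: P rule: psum_induct)
    case (const c)
    show ?case by (rule exI[of _ "const c * P"]) (simp add: form_scale_left form_scale_right)
  next
    case (psum n F)
    from psum.IH[of "pdiff n P"] obtain P' where P': "\<And>Q. form P' Q = form (pdiff n P) (F * Q)" by blast
    show ?case
    proof (intro exI[of _ P'] allI)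
      fix Q
      show "form P' Q = form P (psum n * F * Q)"
        using P' psum.hyps by (simp add: form_commute[of P] form_psum_mult form_commute[of "pdiff n P"] mult.assoc)
    qed
  next
    case (add F G)
    from add.IH[of P] obtain P1 P2 where "\<And>Q. form P1 Q = form P (F * Q)" "\<And>Q. form P2 Q = form P (G * Q)"
      by blast
    then show ?case
      by (intro exI[of _ "P1 + P2"]) (simp add: form_add_left form_add_right distrib_right)
  qed
  then have "\<exists>!P'. \<forall>Q. form P' Q = form P (F * Q)"
    by (metis form_eqI)
  from theI'[OF this] show ?thesis unfolding padj_def by blast
qed

lemma padj_eqI:
  assumes "\<And>Q. form P' Q = form P (F * Q)"
  shows "padj F P = P'"
  by (rule form_eqI) (simp add: form_padj assms)

lemma padj_const: "padj (const c) P = const c * P"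
  by (rule padj_eqI) (simp add: form_scale_left form_scale_right)

lemma padj_1 [simp]: "padj 1 P = P"
  using padj_const[of 1 P] by simp

lemma padj_0 [simp]: "padj 0 P = 0"
  using padj_const[of 0 P] by simp

lemma padj_psum: "n > 0 \<Longrightarrow> padj (psum n) P = pdiff n P"
  by (metis padj_eqI form_psum_mult form_commute)

lemma padj_mult: "padj (F * G) P = padj G (padj F P)"
  by (rule padj_eqI) (simp add: form_padj mult.assoc)

lemma padj_add_left: "padj (F + G) P = padj F P + padj G P"
  by (rule padj_eqI) (simp add: form_padj form_add_left form_add_right distrib_right)

lemma padj_add: "padj F (P + Q) = padj F P + padj F Q"
  by (rule padj_eqI) (simp add: form_padj form_add_left)

lemma padj_scale: "padj F (const c * P) = const c * padj F P"
  by (rule padj_eqI) (simp add: form_padj form_scale_left)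

lemma padj_scale_left: "padj (const c * F) P = const c * padj F P"
  by (simp add: padj_mult padj_const padj_scale)

lemma padj_zero [simp]: "padj F 0 = 0"
  using padj_scale[of F 0 0] by simp

lemma padj_uminus_left: "padj (- F) P = - padj F P"
  using padj_scale_left[of "-1" F P] by (simp add: const_uminus)

lemma padj_uminus: "padj F (- P) = - padj F P"
  using padj_scale[of F "-1" P] by (simp add: const_uminus)

lemma padj_diff_left: "padj (F - G) P = padj F P - padj G P"
  using padj_add_left[of F "- G" P] by (simp add: padj_uminus_left)

lemma padj_sum: "padj F (\<Sum>i\<in>I. f i) = (\<Sum>i\<in>I. padj F (f i))"
  by (induction I rule: infinite_finite_induct) (simp_all add: padj_add)

lemma padj_sum_left: "padj (\<Sum>i\<in>I. f i) P = (\<Sum>i\<in>I. padj (f i) P)"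
  by (induction I rule: infinite_finite_induct) (simp_all add: padj_add_left)

lemma padj_commute: "padj F (padj G P) = padj G (padj F P)"
  by (metis padj_mult mult.commute)

lemma padj_pdiff: "n > 0 \<Longrightarrow> padj F (pdiff n P) = pdiff n (padj F P)"
  by (metis padj_psum padj_commute)

lemma pdiff_commute: "n > 0 \<Longrightarrow> k > 0 \<Longrightarrow> pdiff n (pdiff k P) = pdiff k (pdiff n P)"
  by (metis padj_psum padj_pdiff)

text \<open>The Leibniz rule for \<open>pdiff n (F * Q)\<close>, transposed. All later commutators
  descend from it.\<close>

lemma padj_psum_mult:
  assumes "n > 0"
  shows "padj F (psum n * P) = psum n * padj F P + padj (pdiff n F) P"
proof (rule padj_eqI)
  fix Q
  have "form (psum n * P) (F * Q) = form P (pdiff n F * Q) + form P (F * pdiff n Q)"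
    using assms by (simp add: form_psum_mult pdiff_mult form_add_right)
  then show "form (psum n * padj F P + padj (pdiff n F) P) Q = form (psum n * P) (F * Q)"
    using assms by (simp add: form_add_left form_psum_mult form_padj)
qed

section \<open>The series Omega\<close>

definition rconst :: "rat \<Rightarrow> symfun" where
  "rconst q = const [:q:]"

lemma rconst_mult: "rconst (p * q) = rconst p * rconst q"
  unfolding rconst_def const_mult[symmetric] by (simp add: mult.commute)

lemma rconst_1 [simp]: "rconst 1 = 1"
  using const_1[where ?'c = "rat poly"] by (simp only: rconst_def one_pCons)

lemma rconst_of_nat: "rconst (of_nat n) = of_nat n"
  using const_of_nat[where ?'c = "rat poly", of n] by (simp only: rconst_def of_nat_poly)

lemma rconst_inverse: "n > 0 \<Longrightarrow> of_nat n * rconst (1 / of_nat n) = 1"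
  unfolding rconst_of_nat[symmetric] rconst_mult[symmetric] by simp

text \<open>Coefficients contain the rationals. Newton recursions determine n times an unknown, and
  this lemma removes the n.\<close>

lemma of_nat_mult_cancel_symfun:
  assumes "n > 0" "of_nat n * P = of_nat n * (Q :: symfun)"
  shows "P = Q"
proof -
  have "(rconst (1 / of_nat n) * of_nat n) * P = (rconst (1 / of_nat n) * of_nat n) * Q"
    by (simp only: mult.assoc assms(2))
  then show ?thesis using assms(1) by (simp add: rconst_inverse mult.commute[of _ "of_nat n"])
qed

definition log_Omega :: "symfun \<Rightarrow> symfun fps" where
  "log_Omega A = Abs_fps (\<lambda>k. if k = 0 then 0 else rconst (1 / of_nat k) * adams k A)"

text \<open>\<open>log_Omega A\<close> has no constant term, so its i-th power starts in degree i;
  hence one bound \<open>N\<close> can serve all n up to it.\<close>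

lemma Omega_nth:
  assumes "n \<le> N"
  shows "fps_nth (Omega A) n = (\<Sum>i\<le>N. rconst (1 / fact i) * fps_nth (log_Omega A ^ i) n)"
proof -
  have "fps_nth (Omega A) n = (\<Sum>i\<le>n. rconst (1 / fact i) * fps_nth (log_Omega A ^ i) n)"
    unfolding Omega_def fps_compose_nth log_Omega_def rconst_def by (simp add: atLeast0AtMost)
  also have "\<dots> = (\<Sum>i\<le>N. rconst (1 / fact i) * fps_nth (log_Omega A ^ i) n)"
    using assms by (intro sum.mono_neutral_left)
      (auto simp: startsby_zero_power_prefix log_Omega_def)
  finally show ?thesis .
qed

lemma Omega_nth_0 [simp]: "fps_nth (Omega A) 0 = 1"
  by (simp add: Omega_nth[of 0 0])

text \<open>The chain rule for exp under an abstract derivation, so that it covers both the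
  derivative in z and \<open>pdiff k\<close> taken coefficientwise. The hypothesis
  \<open>local\<close> allows a loss of one degree, as the derivative in z requires, and justifies
  replacing exp by a polynomial.\<close>

lemma derivation_Omega:
  fixes \<delta> :: "symfun fps \<Rightarrow> symfun fps"
  assumes add: "\<And>f g. \<delta> (f + g) = \<delta> f + \<delta> g"
    and mult: "\<And>f g. \<delta> (f * g) = \<delta> f * g + f * \<delta> g"
    and const: "\<And>q. \<delta> (fps_const (rconst q)) = 0"
    and local: "\<And>f n. (\<And>i. i \<le> Suc n \<Longrightarrow> fps_nth f i = 0) \<Longrightarrow> fps_nth (\<delta> f) n = 0"
  shows "\<delta> (Omega A) = Omega A * \<delta> (log_Omega A)"
proof (rule fps_ext)
  fix n
  let ?G = "log_Omega A"
  have d0: "\<delta> 0 = 0" using add[of 0 0] by simp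
  have d1: "\<delta> 1 = 0" using const[of 1] by simp
  have dsum: "\<delta> (\<Sum>i\<in>I. f i) = (\<Sum>i\<in>I. \<delta> (f i))" if "finite I" for f :: "nat \<Rightarrow> _" and I
    using that by (induction I) (simp_all add: add d0)
  have pow: "\<delta> (?G ^ i) = of_nat i * ?G ^ (i - 1) * \<delta> ?G" for i
  proof (induction i)
    case (Suc i)
    have 1: "of_nat i * ?G ^ (i - 1) * ?G = of_nat i * ?G ^ i" by (cases i) (simp_all add: mult_ac)
    have 2: "\<delta> (?G ^ Suc i) = \<delta> ?G * ?G ^ i + (of_nat i * ?G ^ (i - 1) * ?G) * \<delta> ?G"
      unfolding power_Suc mult[of ?G] Suc.IH by (simp add: mult_ac)
    show ?case unfolding 2 1 by (simp add: algebra_simps)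
  qed (simp add: d1)
  \<comment> \<open>Truncated exponentials. Degree n of the derivation needs
    \<open>E (Suc n)\<close>; lowering i cancels against the factorial and leaves
    \<open>E n\<close>.\<close>
  define E where "E N = (\<Sum>i\<le>N. fps_const (rconst (1 / fact i)) * ?G ^ i)" for N
  have E: "fps_nth (E N) i = fps_nth (Omega A) i" if "i \<le> N" for i N
    using that by (simp add: E_def fps_sum_nth Omega_nth)
  have "\<delta> (Omega A) = \<delta> (E (Suc n)) + \<delta> (Omega A - E (Suc n))"
    using add[of "E (Suc n)" "Omega A - E (Suc n)"] by simp
  moreover have "fps_nth (\<delta> (Omega A - E (Suc n))) n = 0"
    by (rule local) (simp add: E)
  ultimately have "fps_nth (\<delta> (Omega A)) n = fps_nth (\<delta> (E (Suc n))) n" by simp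
  also have "\<delta> (E (Suc n)) = (\<Sum>i\<le>Suc n. fps_const (rconst (1 / fact i)) * (of_nat i * ?G ^ (i - 1) * \<delta> ?G))"
    unfolding E_def by (simp add: dsum mult const pow del: sum.atMost_Suc fact_Suc power_Suc)
  also have "\<dots> = (\<Sum>i\<le>n. fps_const (rconst (1 / fact (Suc i))) * (of_nat (Suc i) * ?G ^ i * \<delta> ?G))"
    by (subst sum.atMost_Suc_shift) (simp del: fact_Suc of_nat_Suc)
  also have "\<dots> = (\<Sum>i\<le>n. fps_const (rconst (1 / fact i)) * ?G ^ i * \<delta> ?G)"
  proof (intro sum.cong refl)
    fix i
    have "rconst (1 / fact (Suc i)) * of_nat (Suc i) = rconst (1 / fact i)"
      unfolding rconst_of_nat[symmetric] rconst_mult[symmetric] by simp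
    then have "fps_const (rconst (1 / fact (Suc i))) * of_nat (Suc i) = fps_const (rconst (1 / fact i))"
      by (simp only: fps_of_nat[symmetric] fps_const_mult)
    then show "fps_const (rconst (1 / fact (Suc i))) * (of_nat (Suc i) * ?G ^ i * \<delta> ?G) =
       fps_const (rconst (1 / fact i)) * ?G ^ i * \<delta> ?G"
      by (simp only: mult.assoc[symmetric])
  qed
  also have "\<dots> = E n * \<delta> ?G" by (simp add: E_def sum_distrib_right)
  also have "fps_nth (E n * \<delta> ?G) n = fps_nth (Omega A * \<delta> ?G) n"
    by (simp add: fps_mult_nth E)
  finally show "fps_nth (\<delta> (Omega A)) n = fps_nth (Omega A * \<delta> ?G) n" .
qed

lemma Omega_Newton:
  "of_nat n * fps_nth (Omega A) n = (\<Sum>j=1..n. adams j A * fps_nth (Omega A) (n - j))"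
proof (cases n)
  case (Suc m)
  have "fps_deriv (Omega A) = Omega A * fps_deriv (log_Omega A)"
    by (rule derivation_Omega) (simp_all add: add.commute)
  then have "fps_nth (fps_deriv (Omega A)) m = fps_nth (fps_deriv (log_Omega A) * Omega A) m"
    by (simp add: mult.commute)
  then have "of_nat (Suc m) * fps_nth (Omega A) (Suc m) =
     (\<Sum>i\<le>m. (of_nat (Suc i) * rconst (1 / of_nat (Suc i))) * adams (Suc i) A * fps_nth (Omega A) (m - i))"
    unfolding fps_mult_nth by (simp add: log_Omega_def mult.assoc atLeast0AtMost del: of_nat_Suc)
  also have "\<dots> = (\<Sum>i\<le>m. adams (Suc i) A * fps_nth (Omega A) (m - i))"
    by (simp add: rconst_inverse del: of_nat_Suc)
  also have "\<dots> = (\<Sum>j=1..Suc m. adams j A * fps_nth (Omega A) (Suc m - j))"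
    by (rule sum.reindex_bij_witness[of _ "\<lambda>j. j - 1" Suc]) auto
  finally show ?thesis using Suc by simp
qed simp

lemma pdiff_Omega:
  "pdiff k (fps_nth (Omega A) n) =
   (\<Sum>j=1..n. rconst (1 / of_nat j) * pdiff k (adams j A) * fps_nth (Omega A) (n - j))"
proof -
  define \<delta> where "\<delta> f = Abs_fps (\<lambda>n. pdiff k (fps_nth f n))" for f
  have "\<delta> (Omega A) = Omega A * \<delta> (log_Omega A)"
  proof (rule derivation_Omega)
    fix f g
    show "\<delta> (f * g) = \<delta> f * g + f * \<delta> g"
      by (rule fps_ext) (simp add: \<delta>_def fps_mult_nth pdiff_sum pdiff_mult sum.distrib)
    show "\<delta> (f + g) = \<delta> f + \<delta> g"
      by (rule fps_ext) (simp add: \<delta>_def pdiff_add)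
  next
    fix q
    show "\<delta> (fps_const (rconst q)) = 0"
      by (rule fps_ext) (simp add: \<delta>_def rconst_def)
  qed (simp add: \<delta>_def)
  then have "fps_nth (\<delta> (Omega A)) n = fps_nth (\<delta> (log_Omega A) * Omega A) n"
    by (simp add: mult.commute)
  moreover have "fps_nth (\<delta> (log_Omega A)) i = (if i = 0 then 0 else rconst (1 / of_nat i) * pdiff k (adams i A))" for i
    by (cases "i = 0") (simp_all add: \<delta>_def log_Omega_def rconst_def pdiff_scale)
  ultimately have "pdiff k (fps_nth (Omega A) n) =
     (\<Sum>i=0..n. (if i = 0 then 0 else rconst (1 / of_nat i) * pdiff k (adams i A)) * fps_nth (Omega A) (n - i))"
    unfolding fps_mult_nth by (simp add: \<delta>_def)
  also have "\<dots> = (\<Sum>j=1..n. rconst (1 / of_nat j) * pdiff k (adams j A) * fps_nth (Omega A) (n - j))"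
    by (intro sum.mono_neutral_cong_right) auto
  finally show ?thesis .
qed

lemma comm_ring_hom_coeff_adams: "comm_ring_hom (\<lambda>c. const (coeff_adams k c) :: symfun)"
  by unfold_locales
    (simp_all add: coeff_adams_def pcompose_add pcompose_mult pcompose_1 const_add const_mult)

lemma comm_ring_hom_adams: "comm_ring_hom (adams k)"
  unfolding adams_def using comm_ring_hom_coeff_adams by (rule comm_ring_hom_ps_eval)

lemma adams_psum: "j > 0 \<Longrightarrow> adams k (psum j) = psum (k * j)"
  unfolding adams_def using comm_ring_hom_coeff_adams by (rule ps_eval_psum)

lemma adams_const: "adams k (const c) = const (coeff_adams k c)"
  unfolding adams_def using comm_ring_hom_coeff_adams by (rule ps_eval_const)

lemma adams_alphX: "adams k alphX = psum k"
  by (simp add: alphX_def adams_psum)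

lemma adams_uminus: "adams k (- P) = - adams k P"
proof -
  interpret comm_ring_hom "adams k" by (rule comm_ring_hom_adams)
  show ?thesis by (rule hom_uminus)
qed

section \<open>Complete and elementary symmetric functions\<close>

text \<open>With signs: \<open>esym n\<close> is \<open>(-1)\<^sup>n e\<^sub>n\<close>.\<close>

definition esym :: "int \<Rightarrow> symfun" where
  "esym n = (if n < 0 then 0 else fps_nth (Omega (- alphX)) (nat n))"

text \<open>The alphabets X and -X are the cases \<open>a = 1\<close> and \<open>a = -1\<close>;
  only the summand j = k involves \<open>p\<^sub>k\<close>.\<close>

lemma pdiff_Omega_linear:
  assumes "\<And>j. j > 0 \<Longrightarrow> adams j A = const (a j) * psum j" and "k > 0"
  shows "pdiff k (fps_nth (Omega A) n) = (if k \<le> n then const (a k) * fps_nth (Omega A) (n - k) else 0)"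
proof -
  have "pdiff k (fps_nth (Omega A) n) =
     (\<Sum>j=1..n. if j = k then const (a k) * fps_nth (Omega A) (n - k) else 0)"
    unfolding pdiff_Omega
  proof (intro sum.cong refl)
    fix j assume j: "j \<in> {1..n}"
    have "rconst (1 / of_nat k) * (const (a k) * of_nat k) = const (a k) * (of_nat k * rconst (1 / of_nat k))"
      by (simp add: mult_ac)
    then show "rconst (1 / of_nat j) * pdiff k (adams j A) * fps_nth (Omega A) (n - j) =
       (if j = k then const (a k) * fps_nth (Omega A) (n - k) else 0)"
      using j assms by (auto simp: pdiff_scale pdiff_psum rconst_inverse)
  qed
  then show ?thesis using assms(2) by simp
qed

lemma nat_int_diff: "\<not> n < int k \<Longrightarrow> nat (n - int k) = nat n - k"
  by linarith

lemma pdiff_hsym: "k > 0 \<Longrightarrow> pdiff k (hsym n) = hsym (n - int k)"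
  using pdiff_Omega_linear[of alphX "\<lambda>_. 1" k "nat n"]
  by (auto simp: hsym_def adams_alphX nat_int_diff)

lemma pdiff_esym: "k > 0 \<Longrightarrow> pdiff k (esym n) = - esym (n - int k)"
  using pdiff_Omega_linear[of "- alphX" "\<lambda>_. - 1" k "nat n"]
  by (auto simp: esym_def adams_alphX adams_uminus const_uminus nat_int_diff)

lemma hsym_0 [simp]: "hsym 0 = 1" and esym_0 [simp]: "esym 0 = 1"
  by (simp_all add: hsym_def esym_def)

lemma hsym_neg [simp]: "n < 0 \<Longrightarrow> hsym n = 0" and esym_neg [simp]: "n < 0 \<Longrightarrow> esym n = 0"
  by (simp_all add: hsym_def esym_def)

lemma hsym_Newton: "of_nat n * hsym (int n) = (\<Sum>j=1..n. psum j * hsym (int n - int j))"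
proof -
  have "of_nat n * hsym (int n) = (\<Sum>j=1..n. adams j alphX * fps_nth (Omega alphX) (n - j))"
    by (simp add: hsym_def Omega_Newton)
  also have "\<dots> = (\<Sum>j=1..n. psum j * hsym (int n - int j))"
    by (intro sum.cong refl) (auto simp: hsym_def adams_alphX simp flip: of_nat_diff)
  finally show ?thesis .
qed

lemma esym_Newton: "of_nat n * esym (int n) = - (\<Sum>j=1..n. psum j * esym (int n - int j))"
proof -
  have "of_nat n * esym (int n) = (\<Sum>j=1..n. adams j (- alphX) * fps_nth (Omega (- alphX)) (n - j))"
    by (simp add: esym_def Omega_Newton)
  also have "\<dots> = (\<Sum>j=1..n. - (psum j * esym (int n - int j)))"
    by (intro sum.cong refl) (auto simp: esym_def adams_alphX adams_uminus simp flip: of_nat_diff)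
  finally show ?thesis by (simp add: sum_negf)
qed

lemma padj_of_nat_mult: "padj (of_nat n * F) P = of_nat n * padj F P"
  using padj_scale_left[of "of_nat n" F P] by simp

text \<open>The coefficient of z^n in the statement that \<open>\<Omega>[zX]\<close> acts by skewing
  as the substitution of \<open>p\<^sub>k + z\<^sup>k\<close> for \<open>p\<^sub>k\<close>. With
  \<open>esym\<close> the sign of z^k changes.\<close>

lemma padj_hsym_psum_mult:
  "k > 0 \<Longrightarrow> padj (hsym n) (psum k * P) = psum k * padj (hsym n) P + padj (hsym (n - int k)) P"
  by (simp add: padj_psum_mult pdiff_hsym)

lemma padj_esym_psum_mult:
  "k > 0 \<Longrightarrow> padj (esym n) (psum k * P) = psum k * padj (esym n) P - padj (esym (n - int k)) P"
  by (simp add: padj_psum_mult pdiff_esym padj_uminus_left)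

lemma padj_hsym_const: "padj (hsym n) (const c) = (if n = 0 then const c else 0)"
proof (cases "n > 0")
  case True
  then obtain m where m: "n = int m" "m > 0" by (metis zero_less_imp_eq_int)
  have "of_nat m * padj (hsym n) (const c) = of_nat m * 0"
    unfolding padj_of_nat_mult[symmetric] m hsym_Newton
    by (auto simp: padj_sum_left padj_mult padj_psum intro!: sum.neutral)
  then show ?thesis using of_nat_mult_cancel_symfun[OF m(2)] m by auto
qed (auto simp: not_less le_less)

lemma padj_esym_const: "padj (esym n) (const c) = (if n = 0 then const c else 0)"
proof (cases "n > 0")
  case True
  then obtain m where m: "n = int m" "m > 0" by (metis zero_less_imp_eq_int)
  have "of_nat m * padj (esym n) (const c) = of_nat m * 0"
    unfolding padj_of_nat_mult[symmetric] m esym_Newton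
    by (auto simp: padj_sum_left padj_mult padj_psum padj_uminus_left intro!: sum.neutral)
  then show ?thesis using of_nat_mult_cancel_symfun[OF m(2)] m by auto
qed (auto simp: not_less le_less)

text \<open>In Newton's recursion for \<open>hsym a\<close> every summand reduces to the same
  function, so n equal terms arise and the factor n cancels.\<close>

lemma padj_hsym_hsym: "padj (hsym a) (hsym b) = (if a \<ge> 0 then hsym (b - a) else 0)"
proof (cases "a \<ge> 0")
  case True
  have "padj (hsym (int n)) (hsym b) = hsym (b - int n)" for n
  proof (induction n arbitrary: b rule: less_induct)
    case (less n)
    show ?case
    proof (cases "n = 0")
      case False
      have "of_nat n * padj (hsym (int n)) (hsym b) =
         (\<Sum>j=1..n. padj (hsym (int n - int j)) (hsym (b - int j)))"
        unfolding padj_of_nat_mult[symmetric] hsym_Newton padj_sum_left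
        by (intro sum.cong refl) (simp add: padj_mult padj_psum pdiff_hsym)
      also have "\<dots> = (\<Sum>j=1..n. hsym (b - int n))"
      proof (intro sum.cong refl)
        fix j assume "j \<in> {1..n}"
        then show "padj (hsym (int n - int j)) (hsym (b - int j)) = hsym (b - int n)"
          using less[of "n - j" "b - int j"] by (simp add: of_nat_diff)
      qed
      finally show ?thesis using of_nat_mult_cancel_symfun[of n] False by simp
    qed simp
  qed
  from this[of "nat a"] show ?thesis using True by simp
qed simp

text \<open>This is h_b[X - z] = h_b - z h_(b-1), read off degree by degree in z.\<close>

lemma padj_esym_hsym:
  "padj (esym a) (hsym b) = (if a = 0 then hsym b else if a = 1 then - hsym (b - 1) else 0)"
proof (cases "a \<ge> 0")
  case True
  have "padj (esym (int n)) (hsym b) = (if n = 0 then hsym b else if n = 1 then - hsym (b - 1) else 0)" for n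
  proof (induction n arbitrary: b rule: less_induct)
    case (less n)
    show ?case
    proof (cases "n = 0")
      case False
      have "of_nat n * padj (esym (int n)) (hsym b) =
         - (\<Sum>j=1..n. padj (esym (int n - int j)) (hsym (b - int j)))"
        unfolding padj_of_nat_mult[symmetric] esym_Newton padj_sum_left padj_uminus_left
        by (intro arg_cong[where f = uminus] sum.cong refl) (simp add: padj_mult padj_psum pdiff_hsym)
      \<comment> \<open>Only j = n and j = n - 1 contribute, with opposite signs. For n = 1 the
        second index falls outside the range, which leaves one term.\<close>
      also have "(\<Sum>j=1..n. padj (esym (int n - int j)) (hsym (b - int j))) =
         (\<Sum>j=1..n. (if j = n then hsym (b - int n) else 0) -
            (if j = n - 1 then hsym (b - int n) else 0))"
      proof (intro sum.cong refl)
        fix j assume "j \<in> {1..n}"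
        then show "padj (esym (int n - int j)) (hsym (b - int j)) =
            (if j = n then hsym (b - int n) else 0) - (if j = n - 1 then hsym (b - int n) else 0)"
          using less[of "n - j" "b - int j"] by (auto simp: of_nat_diff algebra_simps)
      qed
      also have "\<dots> = (if n = 1 then hsym (b - 1) else 0)"
        using False by (simp add: sum_subtractf)
      finally show ?thesis using of_nat_mult_cancel_symfun[of n "padj (esym (int n)) (hsym b)" 0] False
        by (cases "n = 1") simp_all
    qed simp
  qed
  from this[of "nat a"] show ?thesis using True by auto
qed simp

text \<open>Skewing \<open>\<Omega>[wX] P\<close> by \<open>\<Omega>[zX]\<close> produces the factor
  1/(1 - zw). Clearing this denominator gives a recursion with two terms; \<open>esym\<close>
  produces the factor 1 - zw directly.\<close>

lemma padj_hsym_mult: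
  "padj (hsym a) (hsym b * P) = hsym b * padj (hsym a) P + padj (hsym (a - 1)) (hsym (b - 1) * P)"
proof (induction P arbitrary: a b rule: psum_induct)
  case (const c)
  show ?case
    by (simp add: mult.commute[of _ "const c"] padj_scale padj_hsym_hsym padj_hsym_const)
next
  case (psum k P)
  show ?case
    unfolding mult.left_commute[of "hsym _" "psum k"] padj_hsym_psum_mult[OF psum.hyps]
      psum.IH[of a b] psum.IH[of "a - int k" b]
    by (simp add: algebra_simps)
next
  case (add P Q)
  show ?case
    unfolding distrib_left padj_add add.IH(1)[of a b] add.IH(2)[of a b] by (simp add: add_ac)
qed

lemma padj_esym_hsym_mult:
  "padj (esym a) (hsym b * P) = hsym b * padj (esym a) P - hsym (b - 1) * padj (esym (a - 1)) P"
proof (induction P arbitrary: a b rule: psum_induct)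
  case (const c)
  show ?case
    by (simp add: mult.commute[of _ "const c"] padj_scale padj_esym_hsym padj_esym_const)
next
  case (psum k P)
  show ?case
    unfolding mult.left_commute[of "hsym _" "psum k"] padj_esym_psum_mult[OF psum.hyps]
      psum.IH[of a b] psum.IH[of "a - int k" b]
    by (simp add: algebra_simps)
next
  case (add P Q)
  then show ?case by (simp add: distrib_left padj_add algebra_simps)
qed

text \<open>Takes the place of a grading: it makes the sum defining \<open>bern\<close> finite. The
  bound grows by k with each factor \<open>p\<^sub>k\<close>.\<close>

lemma padj_esym_eventually_0: "\<exists>N. \<forall>m>N. padj (esym (int m)) P = 0"
proof (induction P rule: psum_induct)
  case (const c)
  show ?case by (rule exI[of _ 0]) (simp add: padj_esym_const)
next
  case (psum k P)
  then obtain N where N: "\<And>m. m > N \<Longrightarrow> padj (esym (int m)) P = 0" by blast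
  have "padj (esym (int m)) (psum k * P) = 0" if "m > N + k" for m
    using that psum.hyps N[of m] N[of "m - k"] by (simp add: padj_esym_psum_mult of_nat_diff)
  then show ?case by blast
next
  case (add P Q)
  then obtain N M where "\<And>m. m > N \<Longrightarrow> padj (esym (int m)) P = 0" "\<And>m. m > M \<Longrightarrow> padj (esym (int m)) Q = 0"
    by blast
  then show ?case by (intro exI[of _ "max N M"]) (simp add: padj_add)
qed

lemma padj_hsym_eventually_0: "\<exists>N. \<forall>m>N. padj (hsym (int m)) P = 0"
proof (induction P rule: psum_induct)
  case (const c)
  show ?case by (rule exI[of _ 0]) (simp add: padj_hsym_const)
next
  case (psum k P)
  then obtain N where N: "\<And>m. m > N \<Longrightarrow> padj (hsym (int m)) P = 0" by blast
  have "padj (hsym (int m)) (psum k * P) = 0" if "m > N + k" for m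
    using that psum.hyps N[of m] N[of "m - k"] by (simp add: padj_hsym_psum_mult of_nat_diff)
  then show ?case by blast
next
  case (add P Q)
  then obtain N M where "\<And>m. m > N \<Longrightarrow> padj (hsym (int m)) P = 0" "\<And>m. m > M \<Longrightarrow> padj (hsym (int m)) Q = 0"
    by blast
  then show ?case by (intro exI[of _ "max N M"]) (simp add: padj_add)
qed

section \<open>Bernstein operators\<close>

text \<open>The alternating signs sit inside \<open>esym\<close>, and \<open>hsym\<close> at
  negative indices absorbs the side condition of \<open>bernstein\<close>.\<close>

definition bern :: "int \<Rightarrow> symfun \<Rightarrow> symfun" where
  "bern r P = Sum_any (\<lambda>m::nat. hsym (r + int m) * padj (esym (int m)) P)"

lemma Sum_any_bounded:
  fixes f :: "nat \<Rightarrow> 'a::comm_monoid_add"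
  assumes "\<And>m. m > N \<Longrightarrow> f m = 0"
  shows "Sum_any f = (\<Sum>m\<le>N. f m)"
  by (rule Sum_any.expand_superset) (use assms in \<open>auto simp: not_less[symmetric]\<close>)

lemma bern_eq:
  assumes "\<And>m. m > N \<Longrightarrow> padj (esym (int m)) P = 0"
  shows "bern r P = (\<Sum>m\<le>N. hsym (r + int m) * padj (esym (int m)) P)"
  unfolding bern_def by (rule Sum_any_bounded) (simp add: assms)

lemma bern_scale: "bern r (const c * P) = const c * bern r P"
proof -
  obtain N where N: "\<And>m. m > N \<Longrightarrow> padj (esym (int m)) P = 0"
    using padj_esym_eventually_0 by blast
  show ?thesis
    by (simp add: bern_eq[of N P] bern_eq[of N "const c * P"] N padj_scale sum_distrib_left mult.left_commute)
qed

lemma bern_add: "bern r (P + Q) = bern r P + bern r Q"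
proof -
  obtain N M where N: "\<And>m. m > N \<Longrightarrow> padj (esym (int m)) P = 0" and M: "\<And>m. m > M \<Longrightarrow> padj (esym (int m)) Q = 0"
    using padj_esym_eventually_0 by meson
  show ?thesis
    by (simp add: bern_eq[of "max N M"] N M padj_add distrib_left sum.distrib)
qed

lemma bern_0 [simp]: "bern r 0 = 0"
  using bern_scale[of r 0 0] by simp

lemma bern_uminus: "bern r (- P) = - bern r P"
  using bern_scale[of r "-1" P] by (simp add: const_uminus)

lemma bern_sum: "bern r (\<Sum>i\<in>I. f i) = (\<Sum>i\<in>I. bern r (f i))"
  by (induction I rule: infinite_finite_induct) (simp_all add: bern_add)

lemma bern_1 [simp]: "bern r 1 = hsym r"
  using bern_eq[of 0 1 r] padj_esym_const[of _ 1] by simp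

lemma bern_psum_mult:
  assumes k: "k > 0"
  shows "bern r (psum k * P) = psum k * bern r P - bern (r + int k) P"
proof -
  obtain N where N: "\<And>m. m > N \<Longrightarrow> padj (esym (int m)) P = 0"
    using padj_esym_eventually_0 by blast
  have "padj (esym (int m)) (psum k * P) = 0" if "m > N + k" for m
    using that k N[of m] N[of "m - k"] by (simp add: padj_esym_psum_mult of_nat_diff)
  then have "bern r (psum k * P) = (\<Sum>m\<le>N+k. hsym (r + int m) * padj (esym (int m)) (psum k * P))"
    by (rule bern_eq)
  also have "\<dots> = psum k * (\<Sum>m\<le>N+k. hsym (r + int m) * padj (esym (int m)) P) -
      (\<Sum>m\<le>N+k. hsym (r + int m) * padj (esym (int m - int k)) P)"
    using k by (simp add: padj_esym_psum_mult sum_distrib_left sum_subtractf right_diff_distrib mult.left_commute)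
  also have "(\<Sum>m\<le>N+k. hsym (r + int m) * padj (esym (int m)) P) = bern r P"
    by (rule bern_eq[symmetric]) (simp add: N)
  also have "(\<Sum>m\<le>N+k. hsym (r + int m) * padj (esym (int m - int k)) P) =
     (\<Sum>m\<in>{k..N+k}. hsym (r + int m) * padj (esym (int m - int k)) P)"
    by (intro sum.mono_neutral_right) auto
  also have "\<dots> = (\<Sum>m\<le>N. hsym (r + int k + int m) * padj (esym (int m)) P)"
    by (rule sum.reindex_bij_witness[of _ "\<lambda>m. m + k" "\<lambda>m. m - k"]) (auto simp: of_nat_diff)
  also have "\<dots> = bern (r + int k) P" by (rule bern_eq[symmetric]) (simp add: N)
  finally show ?thesis .
qed

text \<open>Skewings commute with each other, so only the multiplication inside \<open>bern\<close>
  matters, and \<open>padj_hsym_mult\<close> moves past it.\<close>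

lemma padj_hsym_bern: "padj (hsym a) (bern r P) = bern r (padj (hsym a) P) + padj (hsym (a - 1)) (bern (r - 1) P)"
proof -
  obtain N where N: "\<And>m. m > N \<Longrightarrow> padj (esym (int m)) P = 0"
    using padj_esym_eventually_0 by blast
  have "padj (esym (int m)) (padj (hsym a) P) = 0" if "m > N" for m
    using N[OF that] by (simp add: padj_commute[of "esym _"])
  then show ?thesis
    by (simp add: bern_eq[of N] N padj_sum padj_hsym_mult[of a] sum.distrib padj_commute[of "hsym a"] algebra_simps)
qed

lemma bern_hsym_mult:
  assumes N: "\<And>m. m > N \<Longrightarrow> padj (esym (int m)) P = 0"
  shows "bern r (hsym b * P) =
    (\<Sum>m\<le>N. (hsym (r + int m) * hsym b - hsym (r + 1 + int m) * hsym (b - 1)) * padj (esym (int m)) P)"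
proof -
  have "padj (esym (int m)) (hsym b * P) = 0" if "m > N + 1" for m
    using that N[of m] N[of "m - 1"] by (simp add: padj_esym_hsym_mult of_nat_diff)
  then have "bern r (hsym b * P) = (\<Sum>m\<le>N+1. hsym (r + int m) * padj (esym (int m)) (hsym b * P))"
    by (rule bern_eq)
  also have "\<dots> = (\<Sum>m\<le>N+1. hsym (r + int m) * hsym b * padj (esym (int m)) P) -
      (\<Sum>m\<le>N+1. hsym (r + int m) * hsym (b - 1) * padj (esym (int m - 1)) P)"
    unfolding padj_esym_hsym_mult right_diff_distrib sum_subtractf by (simp only: mult.assoc)
  also have "(\<Sum>m\<le>N+1. hsym (r + int m) * hsym b * padj (esym (int m)) P) =
     (\<Sum>m\<le>N. hsym (r + int m) * hsym b * padj (esym (int m)) P)"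
    by (intro sum.mono_neutral_right) (auto simp: N not_le)
  also have "(\<Sum>m\<le>N+1. hsym (r + int m) * hsym (b - 1) * padj (esym (int m - 1)) P) =
     (\<Sum>m\<le>N. hsym (r + 1 + int m) * hsym (b - 1) * padj (esym (int m)) P)"
    unfolding Suc_eq_plus1[symmetric] sum.atMost_Suc_shift by (simp add: algebra_simps)
  finally show ?thesis by (simp add: left_diff_distrib sum_subtractf)
qed

text \<open>Expanded over pairs of skewings \<open>E m n\<close>, the coefficient changes sign when
  the two index pairs (r, s) and (s - 1, r + 1) are exchanged together with m and n, whereas
  \<open>E\<close> is symmetric.\<close>

lemma bern_bern: "bern r (bern s P) = - bern (s - 1) (bern (r + 1) P)"
proof -
  obtain N where N: "\<And>m. m > N \<Longrightarrow> padj (esym (int m)) P = 0"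
    using padj_esym_eventually_0 by blast
  have N': "padj (esym (int m)) (padj (esym n) P) = 0" if "m > N" for m n
    using N[OF that] by (simp add: padj_commute[of "esym (int m)"])
  define E where "E m n = padj (esym (int m)) (padj (esym (int n)) P)" for m n
  have E: "E m n = E n m" for m n by (simp add: E_def padj_commute)
  have bb: "bern r (bern s P) = (\<Sum>n\<le>N. \<Sum>m\<le>N.
      (hsym (r + int m) * hsym (s + int n) - hsym (r + 1 + int m) * hsym (s + int n - 1)) * E m n)" for r s
    by (simp add: bern_eq[of N P s] N bern_sum bern_hsym_mult[of N] N' E_def)
  have "bern (s - 1) (bern (r + 1) P) = (\<Sum>n\<le>N. \<Sum>m\<le>N.
      (hsym (s - 1 + int n) * hsym (r + 1 + int m) - hsym (s + int n) * hsym (r + int m)) * E m n)"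
    unfolding bb[of "s - 1" "r + 1"] by (subst sum.swap) (simp add: E algebra_simps)
  also have "\<dots> = - bern r (bern s P)"
    unfolding bb[of r s] sum_negf[symmetric]
    by (intro sum.cong refl) (simp add: algebra_simps)
  finally show ?thesis by simp
qed

lemma bern_bern_Suc: "bern (r - 1) (bern r P) = 0"
proof -
  have "of_nat 2 * bern (r - 1) (bern r P) = of_nat 2 * 0"
    using bern_bern[of "r - 1" r P] by (simp add: mult_2 eq_neg_iff_add_eq_0)
  then show ?thesis by (rule of_nat_mult_cancel_symfun[rotated]) simp
qed

text \<open>Inverts the definition of \<open>bern\<close>: the skewing by
  \<open>\<Omega>[-X/z]\<close> is undone by the one by \<open>\<Omega>[X/z]\<close>. It reduces
  multiplication by h_r to operators that are controlled on Schur functions.\<close>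

lemma hsym_mult_eq_bern:
  assumes "\<And>m. m > N \<Longrightarrow> padj (hsym (int m)) P = 0"
  shows "hsym r * P = (\<Sum>m\<le>N. bern (r + int m) (padj (hsym (int m)) P))"
proof -
  define W where "W r P = Sum_any (\<lambda>m::nat. bern (r + int m) (padj (hsym (int m)) P))" for r P
  have W_eq: "W r P = (\<Sum>m\<le>N. bern (r + int m) (padj (hsym (int m)) P))"
    if "\<And>m. m > N \<Longrightarrow> padj (hsym (int m)) P = 0" for N P r
    unfolding W_def by (rule Sum_any_bounded) (simp add: that)
  have "W r P = hsym r * P" for r P
  proof (induction P arbitrary: r rule: psum_induct)
    case (const c)
    have "W r (const c) = bern r (const c)"
      by (subst W_eq[of 0]) (auto simp: padj_hsym_const)
    then show ?case using bern_scale[of r c 1] by (simp add: mult.commute)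
  next
    case (psum k P)
    obtain N where N: "\<And>m. m > N \<Longrightarrow> padj (hsym (int m)) P = 0"
      using padj_hsym_eventually_0 by blast
    have "padj (hsym (int m)) (psum k * P) = 0" if "m > N + k" for m
      using that psum.hyps N[of m] N[of "m - k"] by (simp add: padj_hsym_psum_mult of_nat_diff)
    then have "W r (psum k * P) = (\<Sum>m\<le>N+k. bern (r + int m) (padj (hsym (int m)) (psum k * P)))"
      by (rule W_eq)
    \<comment> \<open>One sum shifted by k comes from \<open>bern\<close> and one from the skewing;
      both equal \<open>W (r + int k) P\<close> and cancel.\<close>
    also have "\<dots> = psum k * (\<Sum>m\<le>N+k. bern (r + int m) (padj (hsym (int m)) P)) -
       (\<Sum>m\<le>N+k. bern (r + int k + int m) (padj (hsym (int m)) P)) +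
       (\<Sum>m\<le>N+k. bern (r + int m) (padj (hsym (int m - int k)) P))"
      using psum.hyps
      by (simp add: padj_hsym_psum_mult bern_add bern_psum_mult sum.distrib sum_subtractf sum_distrib_left add_ac)
    also have "(\<Sum>m\<le>N+k. bern (r + int m) (padj (hsym (int m)) P)) = W r P"
      by (rule W_eq[symmetric]) (simp add: N)
    also have "(\<Sum>m\<le>N+k. bern (r + int k + int m) (padj (hsym (int m)) P)) = W (r + int k) P"
      by (rule W_eq[symmetric]) (simp add: N)
    also have "(\<Sum>m\<le>N+k. bern (r + int m) (padj (hsym (int m - int k)) P)) =
       (\<Sum>m\<in>{k..N+k}. bern (r + int m) (padj (hsym (int m - int k)) P))"
      by (intro sum.mono_neutral_right) auto
    also have "\<dots> = (\<Sum>m\<le>N. bern (r + int k + int m) (padj (hsym (int m)) P))"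
      by (rule sum.reindex_bij_witness[of _ "\<lambda>m. m + k" "\<lambda>m. m - k"]) (auto simp: of_nat_diff)
    also have "\<dots> = W (r + int k) P" by (rule W_eq[symmetric]) (simp add: N)
    finally show ?case using psum.IH by (simp add: mult.left_commute)
  next
    case (add P Q)
    obtain N M where N: "\<And>m. m > N \<Longrightarrow> padj (hsym (int m)) P = 0" and M: "\<And>m. m > M \<Longrightarrow> padj (hsym (int m)) Q = 0"
      using padj_hsym_eventually_0 by meson
    have "W r (P + Q) = W r P + W r Q"
      by (simp add: W_eq[of "max N M"] N M padj_add bern_add sum.distrib)
    then show ?case by (simp add: add distrib_left)
  qed
  then show ?thesis using W_eq[OF assms] by simp
qed

section \<open>Schur functions and Bernstein operators\<close>

text \<open>This is P[X - z] as a power series in z.\<close>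

definition esym_series :: "symfun \<Rightarrow> symfun fps" where
  "esym_series P = Abs_fps (\<lambda>m. padj (esym (int m)) P)"

lemma esym_series_add: "esym_series (P + Q) = esym_series P + esym_series Q"
  by (rule fps_ext) (simp add: esym_series_def padj_add)

lemma esym_series_0 [simp]: "esym_series 0 = 0"
  by (rule fps_ext) (simp add: esym_series_def)

lemma esym_series_sum: "esym_series (\<Sum>i\<in>I. f i) = (\<Sum>i\<in>I. esym_series (f i))"
  by (induction I rule: infinite_finite_induct) (simp_all add: esym_series_add)

lemma esym_series_1 [simp]: "esym_series 1 = 1"
  using padj_esym_const[of _ 1] by (intro fps_ext) (simp add: esym_series_def)

lemma esym_series_signof: "esym_series (signof p * P) = signof p * esym_series P"
  by (auto simp: sign_def esym_series_def fps_eq_iff padj_uminus)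

lemma esym_series_hsym_mult:
  "esym_series (hsym b * P) = (fps_const (hsym b) - fps_X * fps_const (hsym (b - 1))) * esym_series P"
proof (rule fps_ext)
  fix m
  show "fps_nth (esym_series (hsym b * P)) m =
    fps_nth ((fps_const (hsym b) - fps_X * fps_const (hsym (b - 1))) * esym_series P) m"
    by (cases m)
      (simp_all add: esym_series_def padj_esym_hsym_mult left_diff_distrib mult.assoc)
qed

lemma esym_series_prod_hsym:
  "esym_series (\<Prod>i\<in>I. hsym (f i)) = (\<Prod>i\<in>I. fps_const (hsym (f i)) - fps_X * fps_const (hsym (f i - 1)))"
  by (induction I rule: infinite_finite_induct) (simp_all add: esym_series_hsym_mult)

lemma det_mat: "det (mat n n g) = (\<Sum>p | p permutes {0..<n}. signof p * (\<Prod>i = 0..<n. g (i, p i)))"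
  unfolding det_def'[OF mat_carrier]
proof (intro sum.cong refl arg_cong2[where f = "(*)"] prod.cong)
  fix p i assume "p \<in> {p. p permutes {0..<n}}" "i \<in> {0..<n}"
  then show "mat n n g $$ (i, p i) = g (i, p i)"
    using permutes_in_image[of p "{0..<n}" i] by simp
qed

lemma esym_series_det_hsym:
  "esym_series (det (mat n n (\<lambda>(i, j). hsym (f i j)))) =
   det (mat n n (\<lambda>(i, j). fps_const (hsym (f i j)) - fps_X * fps_const (hsym (f i j - 1))))"
  by (simp add: det_mat esym_series_sum esym_series_signof esym_series_prod_hsym)

text \<open>
  The generating function of the \<open>esym m\<^sup>\<bottom> s\<^sub>\<nu>\<close> is the Jacobi--Trudi determinant bordered by the row
  \<open>1, z, z\<^sup>2, \<dots>\<close>: subtracting \<open>z\<close> times the previous column from each column reduces that row to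
  \<open>1, 0, 0, \<dots>\<close>. Expanding along it instead shows that the coefficients are the cofactors that
  occur in the expansion of \<open>s\<^bsub>(r, \<nu>)\<^esub>\<close> along its first row.
\<close>

lemma schur_Cons: "schur (r # \<nu>) = bern (int r) (schur \<nu>)"
proof -
  define L where "L = length \<nu>"
  define a where "a i j = hsym (int ((r # \<nu>) ! i) - int i + int j)" for i j
  define A where "A = mat (Suc L) (Suc L) (\<lambda>(i, j). a i j)"
  define M where "M = mat (Suc L) (Suc L) (\<lambda>(i, j). if i = 0 then fps_X ^ j else fps_const (a i j))"
  define U :: "symfun fps mat" where
    "U = mat (Suc L) (Suc L) (\<lambda>(i, j). if i = j then 1 else if Suc i = j then - fps_X else 0)"
  have A: "A \<in> carrier_mat (Suc L) (Suc L)" by (simp add: A_def)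
  have M: "M \<in> carrier_mat (Suc L) (Suc L)" by (simp add: M_def)
  have U: "U \<in> carrier_mat (Suc L) (Suc L)" by (simp add: U_def)
  have MU: "M * U \<in> carrier_mat (Suc L) (Suc L)" using M U by simp

  interpret fpsc: comm_ring_hom "fps_const :: symfun \<Rightarrow> _" by unfold_locales auto
  \<comment> \<open>The matrices differ only in row 0, which is deleted, so cofactors along that row
    agree.\<close>
  have "mat_delete M 0 j = map_mat fps_const (mat_delete A 0 j)" if "j < Suc L" for j
    using that by (intro eq_matI) (auto simp: mat_delete_def M_def A_def)
  then have cof: "cofactor M 0 j = fps_const (cofactor A 0 j)" if "j < Suc L" for j
    using that by (simp add: cofactor_def fpsc.hom_det fpsc.hom_mult fpsc.hom_power fpsc.hom_uminus)
  have "det M = (\<Sum>j<Suc L. fps_X ^ j * fps_const (cofactor A 0 j))"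
    unfolding laplace_expansion_row[OF M zero_less_Suc]
    by (intro sum.cong refl) (simp add: cof, simp add: M_def)
  then have detM: "fps_nth (det M) m = (if m \<le> L then cofactor A 0 m else 0)" for m
    by (simp add: fps_sum_nth fps_X_power_mult_nth mult_delta_left lessThan_Suc_atMost)

  have MU_0: "(M * U) $$ (i, 0) = M $$ (i, 0)" if "i < Suc L" for i
  proof -
    have "(M * U) $$ (i, 0) = (\<Sum>k<Suc L. M $$ (i, k) * U $$ (k, 0))"
      using that M U by (simp add: scalar_prod_def atLeast0LessThan)
    also have "\<dots> = (\<Sum>k<Suc L. if k = 0 then M $$ (i, 0) else 0)"
      by (intro sum.cong refl) (auto simp: U_def)
    finally show ?thesis by simp
  qed
  have MU_Suc: "(M * U) $$ (i, Suc j) = M $$ (i, Suc j) - fps_X * M $$ (i, j)" if "i < Suc L" "j < L" for i j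
  proof -
    have "(M * U) $$ (i, Suc j) = (\<Sum>k<Suc L. M $$ (i, k) * U $$ (k, Suc j))"
      using that M U by (simp add: scalar_prod_def atLeast0LessThan)
    also have "\<dots> = (\<Sum>k<Suc L. (if k = Suc j then M $$ (i, Suc j) else 0) -
        (if k = j then fps_X * M $$ (i, j) else 0))"
      using that by (intro sum.cong refl) (auto simp: U_def)
    also have "\<dots> = M $$ (i, Suc j) - fps_X * M $$ (i, j)"
      using that unfolding sum_subtractf by simp
    finally show ?thesis .
  qed
  have "det U = 1"
    by (subst det_upper_triangular[OF _ U]) (auto simp: U_def prod_list_diag_prod)
  then have "det M = det (M * U)" by (simp add: det_mult[OF M U])
  also have "\<dots> = (\<Sum>j<Suc L. if j = 0 then det (mat_delete (M * U) 0 0) else 0)"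
    unfolding laplace_expansion_row[OF MU zero_less_Suc]
  proof (intro sum.cong refl)
    fix j assume "j \<in> {..<Suc L}"
    then show "(M * U) $$ (0, j) * cofactor (M * U) 0 j = (if j = 0 then det (mat_delete (M * U) 0 0) else 0)"
      by (cases j) (simp_all add: MU_0 MU_Suc cofactor_def, simp_all add: M_def)
  qed
  also have "\<dots> = det (mat_delete (M * U) 0 0)" by simp
  also have "mat_delete (M * U) 0 0 = mat L L (\<lambda>(i, j). fps_const (hsym (int (\<nu> ! i) - int i + int j)) -
        fps_X * fps_const (hsym (int (\<nu> ! i) - int i + int j - 1)))" (is "_ = ?D")
  proof (rule eq_matI)
    fix i j assume "i < dim_row ?D" "j < dim_col ?D"
    then have ij: "i < L" "j < L" by auto
    then have "mat_delete (M * U) 0 0 $$ (i, j) = (M * U) $$ (Suc i, Suc j)"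
      using carrier_matD[OF M] carrier_matD[OF U] by (simp add: mat_delete_def)
    also have "\<dots> = fps_const (a (Suc i) (Suc j)) - fps_X * fps_const (a (Suc i) j)"
      using ij by (simp add: MU_Suc) (simp add: M_def)
    finally show "mat_delete (M * U) 0 0 $$ (i, j) = ?D $$ (i, j)"
      using ij by (simp add: a_def algebra_simps)
  qed (use carrier_matD[OF M] carrier_matD[OF U] in \<open>simp_all add: mat_delete_def\<close>)
  also have "det ?D = esym_series (schur \<nu>)"
    unfolding schur_def L_def by (rule esym_series_det_hsym[symmetric])
  finally have "padj (esym (int m)) (schur \<nu>) = (if m \<le> L then cofactor A 0 m else 0)" for m
    using detM[of m] by (simp add: esym_series_def)
  then have "bern (int r) (schur \<nu>) = (\<Sum>m\<le>L. hsym (int r + int m) * cofactor A 0 m)"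
    using bern_eq[of L "schur \<nu>" "int r"] by simp
  also have "\<dots> = det A"
    unfolding laplace_expansion_row[OF A zero_less_Suc] lessThan_Suc_atMost[symmetric]
    by (intro sum.cong refl) (simp add: A_def a_def)
  also have "\<dots> = schur (r # \<nu>)" by (simp add: schur_def A_def a_def L_def)
  finally show ?thesis by simp
qed

lemma schur_Nil [simp]: "schur [] = 1"
  by (simp add: schur_def)

text \<open>Integer valued with default 0, so that \<open>bern (first_part \<nu> - 1)\<close> also
  kills the Schur function of the empty partition.\<close>

definition first_part :: "nat list \<Rightarrow> int" where
  "first_part \<nu> = (case \<nu> of [] \<Rightarrow> 0 | n # _ \<Rightarrow> int n)"

lemma first_part_simps [simp]: "first_part [] = 0" "first_part (n # \<nu>) = int n"
  by (simp_all add: first_part_def)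

lemma is_partition_Nil [simp]: "is_partition []"
  by (simp add: is_partition_def)

lemma is_partition_Cons: "is_partition (n # \<nu>) \<longleftrightarrow> n > 0 \<and> first_part \<nu> \<le> int n \<and> is_partition \<nu>"
  by (cases \<nu>) (auto simp: is_partition_def)

lemma bern_first_part_schur: "bern (first_part \<nu> - 1) (schur \<nu>) = 0"
  by (cases \<nu>) (simp_all add: schur_Cons bern_bern_Suc)

text \<open>Straightening by \<open>bern_bern\<close>. The bound on the first part is carried along
  because it lets the row displaced to the front, now shorter by one, form a partition with the
  result below it.\<close>

lemma bern_schur:
  assumes "is_partition \<nu>"
  shows "bern r (schur \<nu>) = 0 \<or>
    (\<exists>\<kappa>. is_partition \<kappa> \<and> first_part \<kappa> \<le> max r (first_part \<nu> - 1) \<and>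
      (bern r (schur \<nu>) = schur \<kappa> \<or> bern r (schur \<nu>) = - schur \<kappa>))"
  using assms
proof (induction \<nu> arbitrary: r)
  case Nil
  consider "r < 0" | "r = 0" | "r > 0" by linarith
  then show ?case
  proof cases
    case 3
    then show ?thesis
      by (intro disjI2 exI[of _ "[nat r]"]) (simp add: schur_Cons is_partition_Cons)
  qed (auto intro: exI[of _ "[]"])
next
  case (Cons n \<nu>)
  then have \<nu>: "is_partition \<nu>" "n > 0" "first_part \<nu> \<le> int n" by (auto simp: is_partition_Cons)
  consider "r \<ge> int n" | "r = int n - 1" | "r < int n - 1" by linarith
  then show ?case
  proof cases
    case 1
    then show ?thesis using \<nu> Cons.prems
      by (intro disjI2 exI[of _ "nat r # n # \<nu>"]) (simp add: schur_Cons is_partition_Cons)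
  next
    case 2
    then show ?thesis by (simp add: schur_Cons bern_bern_Suc)
  next
    case 3
    have swap: "bern r (schur (n # \<nu>)) = - bern (int n - 1) (bern (r + 1) (schur \<nu>))"
      unfolding schur_Cons by (rule bern_bern)
    from Cons.IH[OF \<nu>(1), of "r + 1"] show ?thesis
    proof (elim disjE exE conjE)
      fix \<kappa> assume \<kappa>: "is_partition \<kappa>" "first_part \<kappa> \<le> max (r + 1) (first_part \<nu> - 1)"
      then have le: "first_part \<kappa> \<le> int n - 1" using 3 \<nu> by auto
      obtain \<kappa>' where \<kappa>': "is_partition \<kappa>'" "first_part \<kappa>' \<le> int n - 1"
        "bern (int n - 1) (schur \<kappa>) = schur \<kappa>'"
      \<comment> \<open>The shortened row would have length 0. Then nothing remains below it and
        \<open>bern 0\<close> fixes 1, so the empty partition is the witness.\<close>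
      proof (cases "n = 1")
        case True
        then have "\<kappa> = []" using le \<kappa>(1) by (cases \<kappa>) (auto simp: is_partition_Cons)
        then show ?thesis using that[of "[]"] True by simp
      next
        case False
        then show ?thesis using that[of "(n - 1) # \<kappa>"] \<nu>(2) \<kappa>(1) le
          by (auto simp: is_partition_Cons schur_Cons of_nat_diff)
      qed
      have *: "first_part \<kappa>' \<le> max r (first_part (n # \<nu>) - 1)" using \<kappa>'(2) by simp
      { assume "bern (r + 1) (schur \<nu>) = schur \<kappa>"
        then show ?thesis using swap \<kappa>'(1,3) * by auto }
      { assume "bern (r + 1) (schur \<nu>) = - schur \<kappa>"
        then show ?thesis using swap \<kappa>'(1,3) * by (auto simp: bern_uminus) }
    qed (use swap in simp)
  qed
qed

section \<open>Orthonormality\<close>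

text \<open>\<open>hsym a\<^sup>\<bottom>\<close> removes horizontal strips of size \<open>a\<close>, which number at most one for \<open>a \<ge> \<nu>\<^sub>1\<close>.\<close>

lemma padj_hsym_schur:
  assumes "is_partition \<nu>"
  shows padj_hsym_schur_greater: "a > first_part \<nu> \<Longrightarrow> padj (hsym a) (schur \<nu>) = 0"
    and padj_hsym_schur_first_part: "padj (hsym (first_part \<nu>)) (schur \<nu>) = schur (tl \<nu>)"
proof -
  have "(\<forall>a > first_part \<nu>. padj (hsym a) (schur \<nu>) = 0) \<and>
    padj (hsym (first_part \<nu>)) (schur \<nu>) = schur (tl \<nu>)"
    using assms
  proof (induction \<nu>)
    case Nil
    show ?case using padj_hsym_const[of _ 1] by simp
  next
    case (Cons n \<nu>)
    let ?c = "first_part \<nu>"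
    have \<nu>: "is_partition \<nu>" "?c \<le> int n" using Cons.prems by (auto simp: is_partition_Cons)
    note IH = Cons.IH[OF \<nu>(1), THEN conjunct1, rule_format] Cons.IH[OF \<nu>(1), THEN conjunct2]
    \<comment> \<open>The induction on r starts one below the first part, where \<open>bern\<close>
      kills \<open>schur \<nu>\<close>; \<open>padj_hsym_bern\<close> lowers both indices by
      one.\<close>
    have greater: "\<forall>a>r. padj (hsym a) (bern r (schur \<nu>)) = 0" if "r \<ge> ?c - 1" for r
      using that
    proof (induction r rule: int_ge_induct)
      case (step r)
      then show ?case
        by (auto simp: padj_hsym_bern[of _ "r + 1"] IH(1))
    qed (simp add: bern_first_part_schur)
    have "padj (hsym r) (bern r (schur \<nu>)) = schur \<nu>" if "r \<ge> ?c" for r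
      using that
    proof (induction r rule: int_ge_induct)
      case base
      have "bern ?c (schur (tl \<nu>)) = schur \<nu>" by (cases \<nu>) (simp_all add: schur_Cons)
      then show ?case using IH(2) greater[of "?c - 1"] by (simp add: padj_hsym_bern bern_first_part_schur)
    next
      case (step r)
      then show ?case using IH(1)[of "r + 1"] by (simp add: padj_hsym_bern[of _ "r + 1"])
    qed
    then show ?case using greater[of "int n"] \<nu> by (simp add: schur_Cons)
  qed
  then show "a > first_part \<nu> \<Longrightarrow> padj (hsym a) (schur \<nu>) = 0"
    and "padj (hsym (first_part \<nu>)) (schur \<nu>) = schur (tl \<nu>)" by blast+
qed

lemma form_zero_left [simp]: "form 0 Q = 0" and form_zero_right [simp]: "form Q 0 = 0"
  by (simp_all add: form_def)

lemma form_sum_left: "form (\<Sum>i\<in>I. f i) Q = (\<Sum>i\<in>I. form (f i) Q)"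
  by (induction I rule: infinite_finite_induct) (simp_all add: form_add_left)

text \<open>The factors \<open>hsym (r + int m)\<close> pass to the other argument as skewings. As r
  is at least the first part, all of them with m > 0 annihilate \<open>schur \<nu>\<close>.\<close>

lemma form_bern_schur:
  assumes "is_partition \<nu>" "r \<ge> first_part \<nu>"
  shows "form (bern r P) (schur \<nu>) = (if r = first_part \<nu> then form P (schur (tl \<nu>)) else 0)"
proof -
  obtain N where N: "\<And>m. m > N \<Longrightarrow> padj (esym (int m)) P = 0"
    using padj_esym_eventually_0 by blast
  have adj: "form (F * Q) S = form Q (padj F S)" for F Q S
    by (metis form_commute form_padj)
  have "form (bern r P) (schur \<nu>) =
     (\<Sum>m\<le>N. form (padj (esym (int m)) P) (padj (hsym (r + int m)) (schur \<nu>)))"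
    by (simp add: bern_eq[of N] N form_sum_left adj)
  also have "\<dots> = (\<Sum>m\<le>N. if m = 0 then (if r = first_part \<nu> then form P (schur (tl \<nu>)) else 0) else 0)"
    using assms(2)
    by (intro sum.cong refl)
      (auto simp: padj_hsym_schur_greater[OF assms(1)] padj_hsym_schur_first_part[OF assms(1)])
  finally show ?thesis by simp
qed

text \<open>The larger of the two first rows is the one that is peeled off: unequal rows give 0,
  equal rows leave the tails.\<close>

lemma form_schur:
  assumes "is_partition \<mu>" "is_partition \<nu>"
  shows "form (schur \<mu>) (schur \<nu>) = (if \<mu> = \<nu> then 1 else 0)"
  using assms
proof (induction \<mu> arbitrary: \<nu>)
  case Nil
  show ?case
  proof (cases \<nu>)
    case Nil
    then show ?thesis using form_single_left[of 0 1 1] by simp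
  next
    case (Cons n \<nu>')
    then show ?thesis using form_bern_schur[of "[]" "int n" "schur \<nu>'"] Nil.prems
      by (simp add: is_partition_Cons schur_Cons form_commute[of 1])
  qed
next
  case (Cons m \<mu>)
  note \<mu> = Cons.prems(1)
  show ?case
  proof (cases \<nu>)
    case Nil
    then show ?thesis using form_bern_schur[of "[]" "int m" "schur \<mu>"] \<mu>
      by (simp add: is_partition_Cons schur_Cons)
  next
    case (Cons n \<nu>')
    consider "m > n" | "m < n" | "m = n" by linarith
    then show ?thesis
    proof cases
      case 1
      then show ?thesis using form_bern_schur[of \<nu> "int m" "schur \<mu>"] Cons Cons.prems
        by (simp add: schur_Cons)
    next
      case 2
      then show ?thesis using form_bern_schur[of "m # \<mu>" "int n" "schur \<nu>'"] Cons Cons.prems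
        by (simp add: schur_Cons form_commute[of "bern (int m) _"])
    next
      case 3
      then show ?thesis
        using form_bern_schur[of \<nu> "int m" "schur \<mu>"] Cons Cons.prems Cons.IH[of \<nu>']
        by (simp add: schur_Cons is_partition_Cons)
    qed
  qed
qed

section \<open>The Schur basis\<close>

interpretation symfun: Modules.module scale
  by unfold_locales (simp_all add: scale_def const_add const_mult algebra_simps)

definition schur_span :: "symfun set" where
  "schur_span = symfun.span (schur ` Collect is_partition)"

lemma schur_in_span: "is_partition \<nu> \<Longrightarrow> schur \<nu> \<in> schur_span"
  unfolding schur_span_def by (intro symfun.span_base) auto

lemma schur_span_closed:
  shows schur_span_0: "0 \<in> schur_span"
    and schur_span_add: "P \<in> schur_span \<Longrightarrow> Q \<in> schur_span \<Longrightarrow> P + Q \<in> schur_span"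
    and schur_span_diff: "P \<in> schur_span \<Longrightarrow> Q \<in> schur_span \<Longrightarrow> P - Q \<in> schur_span"
    and schur_span_uminus: "P \<in> schur_span \<Longrightarrow> - P \<in> schur_span"
    and schur_span_scale: "P \<in> schur_span \<Longrightarrow> const c * P \<in> schur_span"
    and schur_span_sum: "(\<And>i. i \<in> I \<Longrightarrow> f i \<in> schur_span) \<Longrightarrow> (\<Sum>i\<in>I. f i) \<in> schur_span"
  unfolding schur_span_def using symfun.span_scale[of P _ c]
  by (auto intro: symfun.span_zero symfun.span_add symfun.span_diff symfun.span_neg symfun.span_sum simp: scale_def)

lemma schur_span_induct [consumes 1, case_names schur scale_add]:
  assumes "P \<in> schur_span"
    and "X 0"
    and "\<And>c \<nu> Q. is_partition \<nu> \<Longrightarrow> X Q \<Longrightarrow> X (const c * schur \<nu> + Q)"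
  shows "X P"
  using assms(1) unfolding schur_span_def
  by (induction rule: symfun.span_induct_alt) (auto simp: scale_def assms)

lemma bern_in_schur_span: "P \<in> schur_span \<Longrightarrow> bern r P \<in> schur_span"
proof (induction rule: schur_span_induct)
  case (scale_add c \<nu> Q)
  have "bern r (schur \<nu>) \<in> schur_span"
    using bern_schur[OF scale_add(1), of r] by (auto simp: schur_span_0 schur_in_span schur_span_uminus)
  then show ?case using scale_add by (simp add: bern_add bern_scale schur_span_add schur_span_scale)
qed (simp add: schur_span_0)

text \<open>Induction on the rows, and inside it on \<open>a\<close> with \<open>r\<close> free,
  because \<open>padj_hsym_bern\<close> leads to the pair (a - 1, r - 1).\<close>

lemma padj_hsym_in_schur_span:
  assumes "P \<in> schur_span"
  shows "padj (hsym a) P \<in> schur_span"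
proof -
  have "padj (hsym (int a)) (schur \<nu>) \<in> schur_span" for \<nu> a
  proof (induction \<nu> arbitrary: a)
    case Nil
    then show ?case using padj_hsym_const[of "int a" 1] schur_in_span[of "[]"] by (auto simp: schur_span_0)
  next
    case (Cons n \<nu>)
    have "padj (hsym (int a)) (bern r (schur \<nu>)) \<in> schur_span" for r
    proof (induction a arbitrary: r)
      case 0
      then show ?case using bern_in_schur_span Cons[of 0] by simp
    next
      case (Suc a)
      then show ?case using padj_hsym_bern[of "int (Suc a)" r "schur \<nu>"] bern_in_schur_span Cons[of "Suc a"]
        by (simp add: schur_span_add)
    qed
    then show ?case by (simp add: schur_Cons)
  qed
  then have *: "padj (hsym a) (schur \<nu>) \<in> schur_span" for \<nu>
    by (cases "a \<ge> 0") (auto simp: schur_span_0 elim: nonneg_int_cases)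
  show ?thesis using assms
    by (induction rule: schur_span_induct) (simp_all add: * schur_span_0 padj_add padj_scale schur_span_add schur_span_scale)
qed

lemma hsym_mult_in_schur_span:
  assumes "P \<in> schur_span"
  shows "hsym r * P \<in> schur_span"
proof -
  obtain N where N: "\<And>m. m > N \<Longrightarrow> padj (hsym (int m)) P = 0"
    using padj_hsym_eventually_0 by blast
  show ?thesis
    by (subst hsym_mult_eq_bern[of N], rule N, assumption)
      (intro schur_span_sum bern_in_schur_span padj_hsym_in_schur_span assms)
qed

lemma psum_mult_in_schur_span:
  assumes "n > 0" "P \<in> schur_span"
  shows "psum n * P \<in> schur_span"
  using assms
proof (induction n arbitrary: P rule: less_induct)
  case (less n)
  have "{1..n} = insert n {1..<n}" using less.prems by auto
  then have "psum n = of_nat n * hsym (int n) - (\<Sum>j=1..<n. psum j * hsym (int n - int j))"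
    using hsym_Newton[of n] by simp
  then have "psum n * P = const (of_nat n) * (hsym (int n) * P) -
      (\<Sum>j=1..<n. psum j * (hsym (int n - int j) * P))"
    by (simp add: left_diff_distrib sum_distrib_right mult.assoc)
  also have "\<dots> \<in> schur_span"
    using less by (intro schur_span_diff schur_span_scale schur_span_sum hsym_mult_in_schur_span less.IH) auto
  finally show ?case .
qed

lemma in_schur_span: "P \<in> schur_span"
proof (induction P rule: psum_induct)
  case (const c)
  show ?case using schur_span_scale[OF schur_in_span[of "[]"], of c] by simp
qed (auto intro: psum_mult_in_schur_span schur_span_add)

lemma schur_induct [case_names zero scale_add]:
  assumes "X 0"
    and "\<And>c \<nu> Q. is_partition \<nu> \<Longrightarrow> X Q \<Longrightarrow> X (const c * schur \<nu> + Q)"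
  shows "X P"
  using in_schur_span assms by (rule schur_span_induct)

section \<open>The Hall scalar product\<close>

lemma module_hom_iff:
  "module_hom scale (*) f \<longleftrightarrow> (\<forall>P Q. f (P + Q) = f P + f Q) \<and> (\<forall>c P. f (const c * P) = c * (f P :: rat poly))"
  unfolding module_hom_def module_hom_axioms_def
  using symfun.module_axioms
  by (auto simp: scale_def Modules.module_def algebra_simps)

text \<open>Orthonormality shows that \<open>form\<close> meets the description, spanning that
  nothing else does.\<close>

lemma hall_eq_form: "hall = form"
  unfolding hall_def
proof (rule the_equality)
  fix b :: "symfun \<Rightarrow> symfun \<Rightarrow> rat poly"
  assume b: "(\<forall>Q. module_hom scale (*) (\<lambda>P. b P Q)) \<and> (\<forall>P. module_hom scale (*) (\<lambda>Q. b P Q)) \<and>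
     (\<forall>\<nu> \<mu>. is_partition \<nu> \<longrightarrow> is_partition \<mu> \<longrightarrow> b (schur \<nu>) (schur \<mu>) = (if \<nu> = \<mu> then 1 else 0))"
  then have l: "b (P + P') Q = b P Q + b P' Q" "b (const c * P) Q = c * b P Q"
    and r: "b P (Q + Q') = b P Q + b P Q'" "b P (const c * Q) = c * b P Q"
    and s: "is_partition \<nu> \<Longrightarrow> is_partition \<mu> \<Longrightarrow> b (schur \<nu>) (schur \<mu>) = form (schur \<nu>) (schur \<mu>)"
    for P P' Q Q' c \<nu> \<mu>
    unfolding module_hom_iff by (auto simp: form_schur)
  have z: "b 0 Q = 0" "b P 0 = 0" for P Q using l(2)[of 0 0 Q] r(2)[of P 0 0] by auto
  have "b (schur \<nu>) Q = form (schur \<nu>) Q" if "is_partition \<nu>" for \<nu> Q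
    by (induction Q rule: schur_induct) (simp_all add: z r s that form_add_right form_scale_right)
  then have "b P Q = form P Q" for P Q
    by (induction P rule: schur_induct) (simp_all add: z l form_add_left form_scale_left)
  then show "b = form" by blast
qed (auto simp: module_hom_iff form_add_left form_add_right form_scale_left form_scale_right form_schur)

lemma perp_eq_padj: "perp = padj"
  by (intro ext) (simp add: perp_def padj_def hall_eq_form)

lemma bernstein_eq_bern: "bernstein = bern"
proof (intro ext)
  fix r P
  show "bernstein r P = bern r P"
    unfolding bernstein_def bern_def perp_eq_padj
    by (rule arg_cong[where f = Sum_any]) (auto simp: hsym_def esym_def)
qed

section \<open>Families of creation operators\<close>

definition slinear :: "(symfun \<Rightarrow> symfun) \<Rightarrow> bool" where
  "slinear V \<longleftrightarrow> (\<forall>P Q. V (P + Q) = V P + V Q) \<and> (\<forall>c P. V (const c * P) = const c * V P)"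

context
  fixes V assumes V: "slinear V"
begin

lemma slinear_add: "V (P + Q) = V P + V Q"
  using V by (simp add: slinear_def)

lemma slinear_scale: "V (const c * P) = const c * V P"
  using V by (simp add: slinear_def)

lemma slinear_0: "V 0 = 0"
  using slinear_scale[of 0 0] by simp

lemma slinear_uminus: "V (- P) = - V P"
  using slinear_scale[of "-1" P] by (simp add: const_uminus)

lemma slinear_diff: "V (P - Q) = V P - V Q"
  using slinear_add[of P "- Q"] by (simp add: slinear_uminus)

lemma slinear_sum: "V (\<Sum>i\<in>I. f i) = (\<Sum>i\<in>I. V (f i))"
  by (induction I rule: infinite_finite_induct) (simp_all add: slinear_add slinear_0)

lemma slinear_of_nat: "V (of_nat n * P) = of_nat n * V P"
  using slinear_scale[of "of_nat n" P] by simp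

lemma slinear_const: "V (const c) = const c * V 1"
  using slinear_scale[of c 1] by simp

end

text \<open>
  This recursion characterises the coefficients \<open>V\<^sub>r\<close> of \<open>z\<^sup>r\<close> in
  \<open>\<Omega>[zX] \<Omega>[azX]\<^sup>\<bottom> \<Omega>[-bz\<^sup>-\<^sup>1X]\<^sup>\<bottom>\<close>, where \<open>p\<^sub>n[a] = a n\<close> and \<open>p\<^sub>n[b] = b n\<close>, because the
  two skewing operators substitute \<open>p\<^sub>n + a\<^sub>n z\<^sup>n - b\<^sub>n z\<^sup>-\<^sup>n\<close> for \<open>p\<^sub>n\<close>.
\<close>

definition creation_family :: "(nat \<Rightarrow> rat poly) \<Rightarrow> (nat \<Rightarrow> rat poly) \<Rightarrow> (int \<Rightarrow> symfun \<Rightarrow> symfun) \<Rightarrow> bool" where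
  "creation_family a b V \<longleftrightarrow> (\<forall>r. slinear (V r)) \<and> (\<forall>r. V r 1 = hsym r) \<and>
    (\<forall>r n P. n > 0 \<longrightarrow> V r (psum n * P) =
       psum n * V r P + const (a n) * V (r - int n) P - const (b n) * V (r + int n) P)"

lemma creation_familyD:
  assumes "creation_family a b V"
  shows "slinear (V r)" "V r 1 = hsym r"
    "n > 0 \<Longrightarrow> V r (psum n * P) =
       psum n * V r P + const (a n) * V (r - int n) P - const (b n) * V (r + int n) P"
  using assms by (auto simp: creation_family_def)

lemma creation_family_bernstein: "creation_family (\<lambda>_. 0) (\<lambda>_. 1) bernstein"
  unfolding bernstein_eq_bern creation_family_def slinear_def
  by (simp add: bern_add bern_scale bern_psum_mult)

text \<open>Differentiating \<open>\<Omega>[zX]\<close> in \<open>p\<^sub>k\<close> brings down z^k,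
  which shifts r by k; the substitution part commutes with skewing.\<close>

lemma pdiff_creation_family:
  assumes V: "creation_family (\<lambda>_. 0) b V" and k: "k > 0"
  shows "pdiff k (V r P) = V r (pdiff k P) + V (r - int k) P"
proof (induction P arbitrary: r rule: psum_induct)
  case (const c)
  show ?case using k
    by (simp add: slinear_const[OF creation_familyD(1)[OF V]] slinear_0[OF creation_familyD(1)[OF V]]
      creation_familyD(2)[OF V] pdiff_scale pdiff_hsym)
next
  case (psum n P)
  note [simp] = creation_familyD(3)[OF V psum.hyps] slinear_add[OF creation_familyD(1)[OF V]]
    slinear_0[OF creation_familyD(1)[OF V]] slinear_of_nat[OF creation_familyD(1)[OF V]]
  let ?D = "if k = n then of_nat k * V r P else 0"
  have lhs: "pdiff k (V r (psum n * P)) = ?D + psum n * pdiff k (V r P) - const (b n) * pdiff k (V (r + int n) P)"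
    using psum.hyps k by (simp add: pdiff_diff pdiff_mult pdiff_psum)
  have rhs: "V r (pdiff k (psum n * P)) = ?D + (psum n * V r (pdiff k P) - const (b n) * V (r + int n) (pdiff k P))"
    using psum.hyps k by (simp add: pdiff_mult pdiff_psum)
  show ?case
    unfolding lhs rhs psum.IH creation_familyD(3)[OF V psum.hyps, of "r - int k"]
    by (simp add: algebra_simps)
next
  case (add P Q)
  then show ?case by (simp add: slinear_add[OF creation_familyD(1)[OF V]] pdiff_add)
qed

section \<open>Skewing by \<Omega>[c f_v]\<close>

text \<open>
  For \<open>E = \<Omega>[a f\<^sub>v]\<^sup>\<bottom>\<close> the commutator of \<open>E\<close> and \<open>p\<^sub>n\<close> is \<open>n (\<partial>\<Omega>[a f\<^sub>v] / \<partial>p\<^sub>n)\<^sup>\<bottom>\<close>, where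
  \<open>\<Omega>[a f\<^sub>v] = exp (\<Sum>\<^sub>k a\<^sub>k (p\<^sub>k\<^sup>2 - p\<^bsub>2k\<^esub>) / (2k))\<close>.
\<close>

definition half_coeff :: "(nat \<Rightarrow> rat poly) \<Rightarrow> nat \<Rightarrow> rat poly" where
  "half_coeff a n = (if even n then a (n div 2) else 0)"

definition domino_skew :: "(nat \<Rightarrow> rat poly) \<Rightarrow> (symfun \<Rightarrow> symfun) \<Rightarrow> bool" where
  "domino_skew a E \<longleftrightarrow> slinear E \<and> E 1 = 1 \<and> (\<forall>n P. n > 0 \<longrightarrow>
     E (psum n * P) = psum n * E P + const (a n) * pdiff n (E P) - const (half_coeff a n) * E P)"

lemma domino_skewD:
  assumes "domino_skew a E"
  shows "slinear E" "E 1 = 1"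
    "n > 0 \<Longrightarrow> E (psum n * P) = psum n * E P + const (a n) * pdiff n (E P) - const (half_coeff a n) * E P"
  using assms by (auto simp: domino_skew_def)

lemma pdiff_domino_skew:
  assumes E: "domino_skew a E" and k: "k > 0"
  shows "pdiff k (E P) = E (pdiff k P)"
proof (induction P rule: psum_induct)
  case (const c)
  show ?case using slinear_const[OF domino_skewD(1)[OF E]] slinear_0[OF domino_skewD(1)[OF E]] domino_skewD(2)[OF E]
    by simp
next
  case (psum n P)
  have eq: "E (pdiff k (psum n * P)) = (if k = n then of_nat k * E P else 0) + E (psum n * pdiff k P)"
    using k psum.hyps
    by (simp add: pdiff_mult pdiff_psum slinear_add[OF domino_skewD(1)[OF E]] slinear_of_nat[OF domino_skewD(1)[OF E]]
        slinear_0[OF domino_skewD(1)[OF E]])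
  have "pdiff k (E (psum n * P)) = (if k = n then of_nat k * E P else 0) + psum n * pdiff k (E P)
     + const (a n) * pdiff k (pdiff n (E P)) - const (half_coeff a n) * pdiff k (E P)"
    using k psum.hyps by (simp add: domino_skewD(3)[OF E] pdiff_add pdiff_diff pdiff_mult pdiff_psum)
  also have "pdiff k (pdiff n (E P)) = pdiff n (pdiff k (E P))"
    using k psum.hyps by (rule pdiff_commute)
  finally show ?case using psum.hyps unfolding eq psum.IH by (simp add: domino_skewD(3)[OF E])
next
  case (add P Q)
  then show ?case by (simp add: slinear_add[OF domino_skewD(1)[OF E]] pdiff_add)
qed

lemma domino_skew_inverse:
  assumes E: "domino_skew a E" and E': "domino_skew a' E'" and a: "\<And>n. n > 0 \<Longrightarrow> a' n = - a n"
  shows "E (E' P) = P"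
proof (induction P rule: psum_induct)
  case (const c)
  show ?case using slinear_const[OF domino_skewD(1)[OF E]] slinear_const[OF domino_skewD(1)[OF E']]
    domino_skewD(2)[OF E] domino_skewD(2)[OF E'] by simp
next
  case (psum n P)
  note lin = slinear_add[OF domino_skewD(1)[OF E]] slinear_diff[OF domino_skewD(1)[OF E]]
    slinear_scale[OF domino_skewD(1)[OF E]]
  have "half_coeff a' n = - half_coeff a n"
    using psum.hyps a[of "n div 2"] by (auto simp: half_coeff_def)
  then show ?case using psum
    by (simp add: domino_skewD(3)[OF E'] domino_skewD(3)[OF E] lin a const_uminus flip: pdiff_domino_skew[OF E])
next
  case (add P Q)
  then show ?case by (simp add: slinear_add[OF domino_skewD(1)[OF E]] slinear_add[OF domino_skewD(1)[OF E']])
qed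

text \<open>Skewing \<open>\<Omega>[zX]\<close> by F multiplies it by F[z], and a single variable
  has no vertical domino: f_v[z] = 0.\<close>

lemma domino_skew_hsym:
  assumes E: "domino_skew a E"
  shows "E (hsym r) = hsym r"
proof (cases "r < 0")
  case True
  then show ?thesis by (simp add: slinear_0[OF domino_skewD(1)[OF E]])
next
  case False
  have "E (hsym (int n)) = hsym (int n)" for n
  proof (induction n rule: less_induct)
    case (less n)
    show ?case
    proof (cases "n = 0")
      case True
      then show ?thesis by (simp add: domino_skewD(2)[OF E])
    next
      case False
      have "of_nat n * E (hsym (int n)) = (\<Sum>j=1..n. E (psum j * hsym (int n - int j)))"
        unfolding slinear_of_nat[OF domino_skewD(1)[OF E], symmetric] hsym_Newton
        by (rule slinear_sum[OF domino_skewD(1)[OF E]])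
      also have "\<dots> = (\<Sum>j=1..n. psum j * hsym (int n - int j) + const (a j) * hsym (int n - 2 * int j)
          - const (half_coeff a j) * hsym (int n - int j))"
      proof (intro sum.cong refl)
        fix j assume j: "j \<in> {1..n}"
        then have "E (hsym (int n - int j)) = hsym (int n - int j)"
          using less[of "n - j"] by (simp add: of_nat_diff)
        then show "E (psum j * hsym (int n - int j)) = psum j * hsym (int n - int j)
            + const (a j) * hsym (int n - 2 * int j) - const (half_coeff a j) * hsym (int n - int j)"
          using j by (simp add: domino_skewD(3)[OF E] pdiff_hsym)
      qed
      also have "\<dots> = of_nat n * hsym (int n) + (\<Sum>j=1..n. const (a j) * hsym (int n - 2 * int j))
          - (\<Sum>j=1..n. const (half_coeff a j) * hsym (int n - int j))"
        by (simp add: hsym_Newton sum_subtractf sum.distrib)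
      also have "(\<Sum>j=1..n. const (half_coeff a j) * hsym (int n - int j)) =
          (\<Sum>j | j \<in> {1..n} \<and> even j. const (half_coeff a j) * hsym (int n - int j))"
        by (intro sum.mono_neutral_right) (auto simp: half_coeff_def)
      \<comment> \<open>Halving the even indices turns these terms into the derivative terms with
        the opposite sign; those with 2j > n vanish.\<close>
      also have "\<dots> = (\<Sum>j=1..n div 2. const (a j) * hsym (int n - 2 * int j))"
        by (rule sum.reindex_bij_witness[of _ "\<lambda>j. 2 * j" "\<lambda>j. j div 2"]) (auto simp: half_coeff_def elim!: evenE)
      also have "\<dots> = (\<Sum>j=1..n. const (a j) * hsym (int n - 2 * int j))"
        by (intro sum.mono_neutral_left) auto
      finally show ?thesis using of_nat_mult_cancel_symfun[of n] False by simp
    qed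
  qed
  from this[of "nat r"] show ?thesis using False by simp
qed

text \<open>The derivative terms of \<open>E\<close> and \<open>E'\<close> would cancel if
  \<open>pdiff n\<close> commuted with \<open>V r\<close>. Its commutator
  \<open>V (r - int n)\<close> survives with coefficient \<open>a n\<close>, while the
  \<open>half_coeff\<close> terms do cancel.\<close>

lemma creation_family_conj:
  assumes V: "creation_family (\<lambda>_. 0) b V"
    and E: "domino_skew a E" and E': "domino_skew a' E'" and a: "\<And>n. n > 0 \<Longrightarrow> a' n = - a n"
  shows "creation_family a b (\<lambda>r. E \<circ> V r \<circ> E')"
  unfolding creation_family_def
proof (intro conjI allI impI)
  note linE = slinear_add[OF domino_skewD(1)[OF E]] slinear_diff[OF domino_skewD(1)[OF E]]
    slinear_scale[OF domino_skewD(1)[OF E]]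
  note linE' = slinear_add[OF domino_skewD(1)[OF E']] slinear_scale[OF domino_skewD(1)[OF E']]
  note linV = slinear_add[OF creation_familyD(1)[OF V]] slinear_diff[OF creation_familyD(1)[OF V]]
    slinear_scale[OF creation_familyD(1)[OF V]]
  fix r
  show "slinear (E \<circ> V r \<circ> E')"
    by (simp add: slinear_def linE linE' linV)
  show "(E \<circ> V r \<circ> E') 1 = hsym r"
    by (simp add: domino_skewD(2)[OF E'] creation_familyD(2)[OF V] domino_skew_hsym[OF E])
  fix n :: nat and P
  assume n: "n > 0"
  define Q where "Q = E' P"
  have half: "half_coeff a' n = - half_coeff a n"
    using n a[of "n div 2"] by (auto simp: half_coeff_def)
  have "E (V r (E' (psum n * P))) = E (V r (psum n * Q)) - const (a n) * E (V r (pdiff n Q))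
      + const (half_coeff a n) * E (V r Q)"
    using n by (simp add: domino_skewD(3)[OF E'] a half const_uminus linE linV flip: Q_def)
  also have "V r (psum n * Q) = psum n * V r Q - const (b n) * V (r + int n) Q"
    using n by (simp add: creation_familyD(3)[OF V])
  also have "V r (pdiff n Q) = pdiff n (V r Q) - V (r - int n) Q"
    using pdiff_creation_family[OF V n] by simp
  finally show "(E \<circ> V r \<circ> E') (psum n * P) = psum n * (E \<circ> V r \<circ> E') P +
      const (a n) * (E \<circ> V (r - int n) \<circ> E') P - const (b n) * (E \<circ> V (r + int n) \<circ> E') P"
    using n by (simp add: domino_skewD(3)[OF E] linE right_diff_distrib Q_def flip: pdiff_domino_skew[OF E])
qed

section \<open>The vertical domino in power sums\<close>

lemma fv_eq: "fv = rconst (1 / 2) * (psum 1 * psum 1 - psum 2)"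
proof -
  have h1: "hsym 1 = psum 1" using hsym_Newton[of 1] by simp
  have h2: "of_nat 2 * hsym 2 = psum 1 * psum 1 + psum 2"
    using hsym_Newton[of 2] h1 by (simp add: eval_nat_numeral)
  have fv: "fv = psum 1 * psum 1 - hsym 2"
    using bern_psum_mult[of 1 1 1] by (simp add: fv_def schur_Cons h1)
  have "of_nat 2 * fv = psum 1 * psum 1 - psum 2"
    unfolding fv right_diff_distrib h2 by simp
  then have "(rconst (1 / 2) * of_nat 2) * fv = rconst (1 / 2) * (psum 1 * psum 1 - psum 2)"
    by (simp only: mult.assoc)
  moreover have "rconst (1 / 2) * of_nat 2 = 1" using rconst_inverse[of 2] by (simp add: mult.commute)
  ultimately show ?thesis by (simp only: mult_1)
qed

lemma coeff_adams_simps [simp]: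
  "coeff_adams k 1 = 1" "coeff_adams k [:q:] = [:q:]"
  "coeff_adams k (c * d) = coeff_adams k c * coeff_adams k d"
  "coeff_adams k (c - d) = coeff_adams k c - coeff_adams k d"
  "coeff_adams k (- c) = - coeff_adams k c"
  "coeff_adams k (c ^ n) = coeff_adams k c ^ n"
proof -
  show "coeff_adams k (c ^ n) = coeff_adams k c ^ n"
    by (induction n) (simp_all add: coeff_adams_def pcompose_1 pcompose_mult)
qed (simp_all add: coeff_adams_def pcompose_1 pcompose_mult pcompose_diff pcompose_uminus)

lemma coeff_adams_tvar: "coeff_adams k tvar = tvar ^ k"
  by (simp add: coeff_adams_def tvar_def pcompose_pCons monom_altdef)

lemma adams_fv:
  assumes "k > 0"
  shows "adams k (const c * fv) = const (coeff_adams k c) * (rconst (1 / 2) * (psum k * psum k - psum (2 * k)))"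
proof -
  interpret comm_ring_hom "adams k" by (rule comm_ring_hom_adams)
  show ?thesis
    by (simp add: fv_eq hom_mult hom_minus adams_const adams_psum rconst_def mult.commute[of k])
qed

text \<open>Homogeneity of degree 2: both \<open>p\<^sub>1\<^sup>2\<close> and
  \<open>p\<^sub>2\<close> acquire the factor t^2.\<close>

lemma fv_t_eq: "fv_t = const (tvar\<^sup>2) * fv"
proof -
  let ?\<phi> = "\<lambda>k. adams k (scale tvar alphX)"
  have \<phi>: "?\<phi> k = const (tvar ^ k) * psum k" for k
  proof -
    interpret comm_ring_hom "adams k" by (rule comm_ring_hom_adams)
    show ?thesis by (simp add: scale_def hom_mult adams_const adams_alphX coeff_adams_tvar)
  qed
  interpret ev: comm_ring_hom "ps_eval const ?\<phi>"
    by (rule comm_ring_hom_ps_eval[OF comm_ring_hom_const])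
  show ?thesis
    unfolding fv_t_def plethysm_def fv_eq ev.hom_mult ev.hom_minus
    by (simp add: rconst_def ps_eval_const[OF comm_ring_hom_const]
      ps_eval_psum[OF comm_ring_hom_const] \<phi> power2_eq_square const_mult algebra_simps)
qed

lemma sum_shift_bounded:
  fixes g :: "nat \<Rightarrow> 'a::comm_monoid_add"
  assumes "\<And>m. m > N \<Longrightarrow> g m = 0" "j \<le> k"
  shows "(\<Sum>m\<le>N+k. if j \<le> m then g (m - j) else 0) = (\<Sum>m\<le>N. g m)"
proof -
  have "(\<Sum>m\<le>N+k. if j \<le> m then g (m - j) else 0) = (\<Sum>m\<in>{j..N+j}. g (m - j))"
    using assms by (intro sum.mono_neutral_cong_right) auto
  also have "\<dots> = (\<Sum>m\<le>N. g m)"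
    by (rule sum.reindex_bij_witness[of _ "\<lambda>m. m + j" "\<lambda>m. m - j"]) auto
  finally show ?thesis .
qed

lemma padj_Omega_domino_psum_mult:
  assumes A: "\<And>k. k > 0 \<Longrightarrow> adams k A = const (a k) * (rconst (1 / 2) * (psum k * psum k - psum (2 * k)))"
    and n: "n > 0"
  shows "padj (fps_nth (Omega A) m) (psum n * P) = psum n * padj (fps_nth (Omega A) m) P
    + (if n \<le> m then const (a n) * pdiff n (padj (fps_nth (Omega A) (m - n)) P) else 0)
    - (if n div 2 \<le> m then const (half_coeff a n) * padj (fps_nth (Omega A) (m - n div 2)) P else 0)"
proof -
  let ?F = "fps_nth (Omega A)"
  have "rconst (1 / of_nat j) * pdiff n (adams j A) =
     (if j = n then const (a n) * psum n else 0) - (if 2 * j = n then const (half_coeff a n) else 0)"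
    if j: "j > 0" for j
  proof -
    have 1: "rconst (1 / of_nat j) * rconst (1 / 2) * (of_nat (2 * j)) = 1"
      using j unfolding rconst_of_nat[symmetric] rconst_mult[symmetric] by simp
    have "rconst (1 / of_nat j) * pdiff n (adams j A) = rconst (1 / of_nat j) * rconst (1 / 2) * const (a j) *
       (2 * (pdiff n (psum j) * psum j) - pdiff n (psum (2 * j)))"
      using j by (simp add: A pdiff_mult pdiff_diff pdiff_scale rconst_def algebra_simps)
    also have "2 * (pdiff n (psum j) * psum j) - pdiff n (psum (2 * j)) =
       of_nat (2 * j) * ((if j = n then psum n else 0) - (if 2 * j = n then 1 else 0))"
      using n j by (auto simp: pdiff_psum algebra_simps)
    also have "rconst (1 / of_nat j) * rconst (1 / 2) * const (a j) *
       (of_nat (2 * j) * ((if j = n then psum n else 0) - (if 2 * j = n then 1 else 0))) =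
       rconst (1 / of_nat j) * rconst (1 / 2) * of_nat (2 * j) * (const (a j) *
       ((if j = n then psum n else 0) - (if 2 * j = n then 1 else 0)))"
      by (simp only: mult_ac)
    finally show ?thesis unfolding 1 by (auto simp: half_coeff_def right_diff_distrib)
  qed
  then have "pdiff n (?F m) = (\<Sum>j=1..m. (if j = n then const (a n) * psum n * ?F (m - n) else 0) -
      (if 2 * j = n then const (half_coeff a n) * ?F (m - n div 2) else 0))"
    unfolding pdiff_Omega by (intro sum.cong refl) (auto simp: left_diff_distrib)
  also have "\<dots> = (if n \<le> m then const (a n) * psum n * ?F (m - n) else 0) -
      (\<Sum>j=1..m. if 2 * j = n then const (half_coeff a n) * ?F (m - n div 2) else 0)"
    using n by (simp add: sum_subtractf)
  \<comment> \<open>The conditions differ for odd n, where \<open>half_coeff a n\<close> is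
    0.\<close>
  also have "(\<Sum>j=1..m. if 2 * j = n then const (half_coeff a n) * ?F (m - n div 2) else 0) =
     (\<Sum>j=1..m. if j = n div 2 then const (half_coeff a n) * ?F (m - n div 2) else 0)"
    by (intro sum.cong refl) (auto simp: half_coeff_def)
  also have "\<dots> = (if n div 2 \<le> m then const (half_coeff a n) * ?F (m - n div 2) else 0)"
    using n by (auto simp: half_coeff_def elim!: evenE)
  finally have "padj (pdiff n (?F m)) P =
     (if n \<le> m then const (a n) * pdiff n (padj (?F (m - n)) P) else 0)
    - (if n div 2 \<le> m then const (half_coeff a n) * padj (?F (m - n div 2)) P else 0)"
    using n by (simp add: padj_diff_left padj_scale_left padj_mult padj_psum padj_pdiff padj_const padj_scale pdiff_scale)
  then show ?thesis using n by (simp add: padj_psum_mult)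
qed

text \<open>Summing the preceding commutators over all degrees erases both shifts.\<close>

lemma domino_skew_Omega_perp: "domino_skew (\<lambda>k. coeff_adams k c) (Omega_perp (const c * fv))"
proof -
  define a where "a k = coeff_adams k c" for k
  define A where "A = const c * fv"
  let ?F = "fps_nth (Omega A)"
  define E where "E = Omega_perp A"
  have A: "adams k A = const (a k) * (rconst (1 / 2) * (psum k * psum k - psum (2 * k)))" if "k > 0" for k
    using that by (simp add: A_def a_def adams_fv)
  note comm = padj_Omega_domino_psum_mult[OF A]
  \<comment> \<open>By Newton's recursion each coefficient of positive degree is built from
    multiples of \<open>adams j A\<close>, whose adjoints kill constants.\<close>
  have F_const: "padj (?F m) (const d) = 0" if "m > 0" for m d
  proof -
    have "padj (adams j A) (const d) = 0" if "j > 0" for j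
      using that by (simp add: A rconst_def padj_scale_left padj_diff_left padj_mult padj_const padj_psum pdiff_scale)
    then have "of_nat m * padj (?F m) (const d) = of_nat m * 0"
      unfolding padj_of_nat_mult[symmetric] Omega_Newton padj_sum_left
      by (simp add: padj_mult)
    then show ?thesis using that by (rule of_nat_mult_cancel_symfun[rotated])
  qed
  have bound_psum: "padj (?F m) (psum n * P) = 0"
    if "\<And>m. m > N \<Longrightarrow> padj (?F m) P = 0" "n > 0" "m > N + n" for N n m P
    using that comm[of n m P] by simp
  have ev: "\<exists>N. \<forall>m>N. padj (?F m) P = 0" for P
  proof (induction P rule: psum_induct)
    case (const d)
    then show ?case by (metis F_const)
  next
    case (psum n P)
    then show ?case using bound_psum by metis
  next
    case (add P Q)
    then obtain N M where "\<And>m. m > N \<Longrightarrow> padj (?F m) P = 0" "\<And>m. m > M \<Longrightarrow> padj (?F m) Q = 0"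
      by blast
    then show ?case by (intro exI[of _ "max N M"]) (simp add: padj_add)
  qed
  have E_eq: "E P = (\<Sum>m\<le>N. padj (?F m) P)" if "\<And>m. m > N \<Longrightarrow> padj (?F m) P = 0" for N P
    unfolding E_def Omega_perp_def perp_eq_padj by (rule Sum_any_bounded) (rule that)
  have "domino_skew a E"
    unfolding domino_skew_def slinear_def
  proof (intro conjI allI impI)
    fix P Q
    obtain N M where "\<And>m. m > N \<Longrightarrow> padj (?F m) P = 0" "\<And>m. m > M \<Longrightarrow> padj (?F m) Q = 0"
      using ev by meson
    then show "E (P + Q) = E P + E Q"
      by (simp add: E_eq[of "max N M"] padj_add sum.distrib)
  next
    fix d P
    obtain N where "\<And>m. m > N \<Longrightarrow> padj (?F m) P = 0"
      using ev by meson
    then show "E (const d * P) = const d * E P"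
      by (simp add: E_eq[of N] padj_scale sum_distrib_left)
  next
    show "E 1 = 1" using F_const[of _ 1] by (simp add: E_eq[of 0])
  next
    fix n :: nat and P
    assume n: "n > 0"
    obtain N where N: "\<And>m. m > N \<Longrightarrow> padj (?F m) P = 0"
      using ev by meson
    have EP: "E P = (\<Sum>m\<le>N. padj (?F m) P)" by (rule E_eq) (rule N)
    \<comment> \<open>The range up to \<open>N + n\<close> is long enough for each shifted sum to
      contain all its nonzero terms.\<close>
    have "E (psum n * P) = (\<Sum>m\<le>N+n. padj (?F m) (psum n * P))"
      by (rule E_eq) (rule bound_psum[OF N n])
    also have "\<dots> = psum n * (\<Sum>m\<le>N+n. padj (?F m) P)
      + (\<Sum>m\<le>N+n. if n \<le> m then const (a n) * pdiff n (padj (?F (m - n)) P) else 0)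
      - (\<Sum>m\<le>N+n. if n div 2 \<le> m then const (half_coeff a n) * padj (?F (m - n div 2)) P else 0)"
      using n by (simp only: comm sum.distrib sum_subtractf sum_distrib_left)
    also have "(\<Sum>m\<le>N+n. padj (?F m) P) = E P"
      by (rule E_eq[symmetric]) (simp add: N)
    also have "(\<Sum>m\<le>N+n. if n \<le> m then const (a n) * pdiff n (padj (?F (m - n)) P) else 0) =
        const (a n) * pdiff n (E P)"
      unfolding EP pdiff_sum sum_distrib_left by (rule sum_shift_bounded) (simp_all add: N)
    also have "(\<Sum>m\<le>N+n. if n div 2 \<le> m then const (half_coeff a n) * padj (?F (m - n div 2)) P else 0) =
        const (half_coeff a n) * E P"
      unfolding EP sum_distrib_left by (rule sum_shift_bounded) (simp_all add: N)
    finally show "E (psum n * P) = psum n * E P + const (a n) * pdiff n (E P) - const (half_coeff a n) * E P" .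
  qed
  then show ?thesis by (simp add: a_def[abs_def] E_def A_def)
qed

lemma domino_skew_minus_fv: "domino_skew (\<lambda>_. - 1) (Omega_perp (- fv))"
  and domino_skew_fv: "domino_skew (\<lambda>_. 1) (Omega_perp fv)"
  and domino_skew_fv_t_diff: "domino_skew (\<lambda>k. (tvar\<^sup>2) ^ k - 1) (Omega_perp (fv_t - fv))"
  and domino_skew_fv_diff_t: "domino_skew (\<lambda>k. 1 - (tvar\<^sup>2) ^ k) (Omega_perp (fv - fv_t))"
proof -
  have [simp]: "coeff_adams k (tvar\<^sup>2) = (tvar\<^sup>2) ^ k" for k
    by (simp add: coeff_adams_tvar power_mult[symmetric] mult.commute)
  show "domino_skew (\<lambda>_. - 1) (Omega_perp (- fv))"
    using domino_skew_Omega_perp[of "- 1"] by (simp add: const_uminus)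
  show "domino_skew (\<lambda>_. 1) (Omega_perp fv)"
    using domino_skew_Omega_perp[of 1] by simp
  show "domino_skew (\<lambda>k. (tvar\<^sup>2) ^ k - 1) (Omega_perp (fv_t - fv))"
    using domino_skew_Omega_perp[of "tvar\<^sup>2 - 1"]
    by (simp add: fv_t_eq const_diff left_diff_distrib del: coeff_adams_simps(6))
  show "domino_skew (\<lambda>k. 1 - (tvar\<^sup>2) ^ k) (Omega_perp (fv - fv_t))"
    using domino_skew_Omega_perp[of "1 - tvar\<^sup>2"]
    by (simp add: fv_t_eq const_diff left_diff_distrib del: coeff_adams_simps(6))
qed

section \<open>The t-analogue of a family\<close>

lemma comm_ring_hom_inX_const: "comm_ring_hom (\<lambda>c. inX (const c))"
  by unfold_locales (simp_all add: inX_def const_add const_mult)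

lemma comm_ring_hom_inY: "comm_ring_hom inY"
  unfolding inY_def by (rule comm_ring_hom_ps_eval[OF comm_ring_hom_inX_const])

lemma comm_ring_hom_mixXY: "comm_ring_hom (mixXY c)"
  unfolding mixXY_def by (rule comm_ring_hom_ps_eval[OF comm_ring_hom_inX_const])

lemma comm_ring_hom_id: "comm_ring_hom (\<lambda>P::'a::comm_ring_1. P)"
  by unfold_locales auto

lemma comm_ring_hom_Y_to_X: "comm_ring_hom Y_to_X"
  unfolding Y_to_X_def by (rule comm_ring_hom_ps_eval[OF comm_ring_hom_id])

lemma Y_to_X_inX: "Y_to_X (inX P) = P"
  by (simp add: Y_to_X_def inX_def ps_eval_const[OF comm_ring_hom_id])

lemma Y_to_X_inY: "Y_to_X (inY P) = P"
proof -
  interpret y: comm_ring_hom inY by (rule comm_ring_hom_inY)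
  interpret yx: comm_ring_hom Y_to_X by (rule comm_ring_hom_Y_to_X)
  show ?thesis
  proof (induction P rule: psum_induct)
    case (const c)
    show ?case by (simp add: inY_def ps_eval_const[OF comm_ring_hom_inX_const] Y_to_X_inX)
  next
    case (psum n P)
    have "Y_to_X (inY (psum n)) = psum n" using psum.hyps
      by (simp add: inY_def Y_to_X_def ps_eval_psum[OF comm_ring_hom_inX_const] ps_eval_psum[OF comm_ring_hom_id])
    then show ?case using psum.IH by (simp add: y.hom_mult yx.hom_mult)
  qed (simp add: y.hom_add yx.hom_add)
qed

definition collapse :: "(symfun \<Rightarrow> symfun) \<Rightarrow> symfun2 \<Rightarrow> symfun" where
  "collapse V Q = Y_to_X (actY V Q)"

lemma collapse_eq:
  "collapse V Q = (\<Sum>m\<in>Poly_Mapping.keys Q. Poly_Mapping.lookup Q m * V (Poly_Mapping.single m 1))"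
proof -
  interpret yx: comm_ring_hom Y_to_X by (rule comm_ring_hom_Y_to_X)
  show ?thesis
    by (simp add: collapse_def actY_def yx.hom_sum yx.hom_mult Y_to_X_inX Y_to_X_inY)
qed

lemma collapse_add: "collapse V (P + Q) = collapse V P + collapse V Q"
  unfolding collapse_eq
  by (rule keys_sum_additive[of "\<lambda>m A. A * V (Poly_Mapping.single m 1)"]) (simp_all add: distrib_right)

lemma collapse_single: "collapse V (Poly_Mapping.single m A) = A * V (Poly_Mapping.single m 1)"
  unfolding collapse_eq
  by (rule keys_sum_single[of "\<lambda>m A. A * V (Poly_Mapping.single m 1)"]) simp

lemma collapse_inX_mult: "collapse V (inX A * Q) = A * collapse V Q"
  by (induction Q rule: poly_mapping_additive_induct)
    (simp_all add: inX_def const_mult_single collapse_single collapse_add mult.assoc distrib_left)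

text \<open>On the left \<open>psum n\<close> belongs to the alphabet Y, on the right to X.
  Coefficients in X are scalars for the operator, so its commutator is inherited.\<close>

lemma collapse_psum_mult:
  assumes V: "creation_family a b V" and n: "n > 0"
  shows "collapse (V r) (psum n * Q) =
    psum n * collapse (V r) Q + const (a n) * collapse (V (r - int n)) Q - const (b n) * collapse (V (r + int n)) Q"
proof (induction Q rule: poly_mapping_additive_induct)
  case (single m A)
  obtain j where j: "n = Suc j" using n by (cases n) auto
  have "collapse (V r) (psum n * Poly_Mapping.single m A) = A * V r (psum n * Poly_Mapping.single m 1)"
    by (simp add: j single_psum_mult collapse_single)
  then show ?case
    by (simp add: creation_familyD(3)[OF V n] collapse_single algebra_simps)
next
  case (add P Q)
  then show ?case by (simp add: distrib_left collapse_add)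
qed

text \<open>Writing c_n for c(t^n), \<open>p\<^sub>n\<close> becomes c_n \<open>p\<^sub>n[X]\<close>
  plus (1 - c_n) \<open>p\<^sub>n[Y]\<close>. Only the second part meets the operator, which scales
  the commutator by 1 - c_n; the two multiples of \<open>p\<^sub>n\<close> add up to one.\<close>

lemma creation_family_analogue:
  assumes V: "creation_family a b V"
  shows "creation_family (\<lambda>n. (1 - coeff_adams n c) * a n) (\<lambda>n. (1 - coeff_adams n c) * b n)
    (\<lambda>r. analogue c (V r))"
  unfolding creation_family_def slinear_def
proof (intro conjI allI impI)
  interpret mix: comm_ring_hom "mixXY c" by (rule comm_ring_hom_mixXY)
  interpret y: comm_ring_hom inY by (rule comm_ring_hom_inY)
  have an: "analogue c (V r) P = collapse (V r) (mixXY c P)" for r P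
    by (simp add: analogue_def collapse_def)
  have mix_const: "mixXY c (const d) = inX (const d)" for d
    by (simp add: mixXY_def ps_eval_const[OF comm_ring_hom_inX_const])
  fix r P
  show "analogue c (V r) (P + Q) = analogue c (V r) P + analogue c (V r) Q" for Q
    by (simp add: an mix.hom_add collapse_add)
  show "analogue c (V r) (const d * P) = const d * analogue c (V r) P" for d
    by (simp add: an mix.hom_mult mix_const collapse_inX_mult)
  show "analogue c (V r) 1 = hsym r"
    using collapse_single[of "V r" 0 1] by (simp add: an creation_familyD(2)[OF V])
  fix n :: nat assume n: "n > 0"
  let ?g = "coeff_adams n c"
  have "inY (const d) = inX (const d)" for d
    by (simp add: inY_def ps_eval_const[OF comm_ring_hom_inX_const])
  moreover have "inY (psum n) = psum n"
    using n by (simp add: inY_def ps_eval_psum[OF comm_ring_hom_inX_const])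
  ultimately have "mixXY c (psum n) = inX (const ?g * psum n) + inX (const (1 - ?g)) * psum n"
    using n by (simp add: mixXY_def ps_eval_psum[OF comm_ring_hom_inX_const] scale_def y.hom_mult)
  then have "analogue c (V r) (psum n * P) =
     const ?g * psum n * analogue c (V r) P + const (1 - ?g) * collapse (V r) (psum n * mixXY c P)"
    by (simp add: an mix.hom_mult distrib_right collapse_add collapse_inX_mult mult.assoc)
  also have "\<dots> = psum n * analogue c (V r) P + const ((1 - ?g) * a n) * analogue c (V (r - int n)) P
     - const ((1 - ?g) * b n) * analogue c (V (r + int n)) P"
    unfolding collapse_psum_mult[OF V n] by (simp add: an const_mult const_diff algebra_simps)
  finally show "analogue c (V r) (psum n * P) = psum n * analogue c (V r) P +
     const ((1 - ?g) * a n) * analogue c (V (r - int n)) P - const ((1 - ?g) * b n) * analogue c (V (r + int n)) P" .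
qed

section \<open>The substitution of the square of t\<close>

definition sq_subst :: "rat poly \<Rightarrow> rat poly" where
  "sq_subst c = pcompose c (tvar\<^sup>2)"

lemma comm_ring_hom_sq_subst: "comm_ring_hom sq_subst"
  by unfold_locales (simp_all add: sq_subst_def pcompose_add pcompose_mult pcompose_1)

interpretation sq: comm_ring_hom sq_subst by (rule comm_ring_hom_sq_subst)

lemma lookup_t_to_t2: "Poly_Mapping.lookup (t_to_t2 P) m = sq_subst (Poly_Mapping.lookup P m)"
  by (simp add: t_to_t2_def Poly_Mapping.map.rep_eq sq_subst_def when_def)

lemma t_to_t2_single: "t_to_t2 (Poly_Mapping.single m c) = Poly_Mapping.single m (sq_subst c)"
  by (rule poly_mapping_eqI) (simp add: lookup_t_to_t2 lookup_single when_def)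

lemma t_to_t2_add: "t_to_t2 (P + Q) = t_to_t2 P + t_to_t2 Q"
  by (rule poly_mapping_eqI) (simp add: lookup_t_to_t2 lookup_add sq.hom_add)

lemma t_to_t2_mult: "t_to_t2 (P * Q) = t_to_t2 P * t_to_t2 Q"
proof (induction P rule: poly_mapping_additive_induct)
  case (single m c)
  show ?case
    by (induction Q rule: poly_mapping_additive_induct)
      (simp_all add: mult_single t_to_t2_single sq.hom_mult t_to_t2_add distrib_left)
qed (simp add: distrib_right t_to_t2_add)

lemma t_to_t2_const: "t_to_t2 (const c) = const (sq_subst c)"
  by (simp add: const_def t_to_t2_single)

lemma t_to_t2_psum: "t_to_t2 (psum n) = psum n"
  by (simp add: psum_def t_to_t2_single)

interpretation tt: comm_ring_hom t_to_t2
  using t_to_t2_const[of 0] t_to_t2_const[of 1]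
  by unfold_locales (simp_all add: t_to_t2_add t_to_t2_mult)

lemma t_to_t2_hsym: "t_to_t2 (hsym r) = hsym r"
proof (cases "r < 0")
  case False
  have "t_to_t2 (hsym (int n)) = hsym (int n)" for n
  proof (induction n rule: less_induct)
    case (less n)
    show ?case
    proof (cases "n = 0")
      case False
      have "of_nat n * t_to_t2 (hsym (int n)) = (\<Sum>j=1..n. t_to_t2 (psum j * hsym (int n - int j)))"
        using arg_cong[OF hsym_Newton[of n], of t_to_t2] by (simp add: tt.hom_mult tt.hom_sum tt.hom_of_nat)
      also have "\<dots> = (\<Sum>j=1..n. psum j * hsym (int n - int j))"
      proof (intro sum.cong refl)
        fix j assume "j \<in> {1..n}"
        then show "t_to_t2 (psum j * hsym (int n - int j)) = psum j * hsym (int n - int j)"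
          using less[of "n - j"] by (simp add: of_nat_diff tt.hom_mult t_to_t2_psum)
      qed
      finally have "of_nat n * t_to_t2 (hsym (int n)) = of_nat n * hsym (int n)"
        by (simp only: hsym_Newton)
      then show ?thesis by (rule of_nat_mult_cancel_symfun[rotated]) (use False in simp)
    qed simp
  qed
  from this[of "nat r"] show ?thesis using False by simp
qed simp

text \<open>The substitution carries one defining recursion to the other. With
  \<open>bernstein\<close> on both sides this also gives the invariance of Schur functions.\<close>

lemma t_to_t2_creation_family:
  assumes V: "creation_family a b V" and W: "creation_family a' b' W"
    and a: "\<And>n. n > 0 \<Longrightarrow> a' n = sq_subst (a n)" and b: "\<And>n. n > 0 \<Longrightarrow> b' n = sq_subst (b n)"
  shows "t_to_t2 (V r P) = W r (t_to_t2 P)"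
proof (induction P arbitrary: r rule: psum_induct)
  case (const c)
  show ?case
    by (simp add: slinear_const[OF creation_familyD(1)[OF V]] slinear_const[OF creation_familyD(1)[OF W]]
      creation_familyD(2)[OF V] creation_familyD(2)[OF W] tt.hom_mult t_to_t2_const t_to_t2_hsym)
next
  case (psum n P)
  then show ?case
    by (simp add: tt.hom_mult tt.hom_add tt.hom_minus t_to_t2_psum t_to_t2_const
      creation_familyD(3)[OF V] creation_familyD(3)[OF W] a b)
next
  case (add P Q)
  then show ?case
    by (simp add: tt.hom_add slinear_add[OF creation_familyD(1)[OF V]] slinear_add[OF creation_familyD(1)[OF W]])
qed

lemma t_to_t2_schur: "t_to_t2 (schur \<nu>) = schur \<nu>"
  by (induction \<nu>)
    (simp_all add: schur_Cons t_to_t2_creation_family[OF creation_family_bernstein creation_family_bernstein] flip: bernstein_eq_bern)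

lemma t_to_t2_pdiff: "n > 0 \<Longrightarrow> t_to_t2 (pdiff n P) = pdiff n (t_to_t2 P)"
proof (induction P rule: psum_induct)
  case (psum k P)
  then show ?case
    by (simp add: pdiff_mult pdiff_psum tt.hom_mult tt.hom_add tt.hom_of_nat t_to_t2_psum)
qed (simp_all add: t_to_t2_const pdiff_add tt.hom_add)

lemma t_to_t2_Omega_perp_fv: "t_to_t2 (Omega_perp fv P) = Omega_perp fv (t_to_t2 P)"
proof (induction P rule: psum_induct)
  case (const c)
  show ?case
    by (simp add: slinear_const[OF domino_skewD(1)[OF domino_skew_fv]] domino_skewD(2)[OF domino_skew_fv] t_to_t2_const)
next
  case (psum n P)
  have [simp]: "half_coeff (\<lambda>_. 1) n = of_bool (even n)" by (simp add: half_coeff_def)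
  show ?case using psum
    by (simp add: domino_skewD(3)[OF domino_skew_fv] tt.hom_mult tt.hom_add tt.hom_minus
        t_to_t2_psum t_to_t2_pdiff)
next
  case (add P Q)
  then show ?case by (simp add: tt.hom_add slinear_add[OF domino_skewD(1)[OF domino_skew_fv]])
qed

lemma sq_subst_zcoef: "sq_subst (zcoef m) = zcoef m"
  unfolding zcoef_def sq.hom_prod sq.hom_of_nat ..

lemma form_t_to_t2: "form (t_to_t2 P) (t_to_t2 Q) = sq_subst (form P Q)"
  by (induction P rule: poly_mapping_additive_induct)
    (simp_all add: t_to_t2_single form_single_left lookup_t_to_t2 sq.hom_mult sq_subst_zcoef
      tt.hom_add form_add_left sq.hom_add)

section \<open>Coefficients with respect to the domino Schur basis\<close>

lemma schur_expansion:
  shows "finite {\<nu>. is_partition \<nu> \<and> form P (schur \<nu>) \<noteq> 0}"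
    and "P = (\<Sum>\<nu> | is_partition \<nu> \<and> form P (schur \<nu>) \<noteq> 0. const (form P (schur \<nu>)) * schur \<nu>)"
proof -
  have "\<exists>F c. finite F \<and> F \<subseteq> Collect is_partition \<and> P = (\<Sum>\<nu>\<in>F. const (c \<nu>) * schur \<nu>)"
  proof (induction P rule: schur_induct)
    case zero
    show ?case by (rule exI[of _ "{}"]) simp
  next
    case (scale_add d \<nu> Q)
    then obtain F c where F: "finite F" "F \<subseteq> Collect is_partition" "Q = (\<Sum>\<nu>\<in>F. const (c \<nu>) * schur \<nu>)"
      by blast
    define c' where "c' \<kappa> = (if \<kappa> \<in> F then c \<kappa> else 0) + (if \<kappa> = \<nu> then d else 0)" for \<kappa>
    have "(\<Sum>\<kappa>\<in>insert \<nu> F. const (c' \<kappa>) * schur \<kappa>) =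
       (\<Sum>\<kappa>\<in>insert \<nu> F. if \<kappa> \<in> F then const (c \<kappa>) * schur \<kappa> else 0) +
       (\<Sum>\<kappa>\<in>insert \<nu> F. if \<kappa> = \<nu> then const d * schur \<nu> else 0)"
      unfolding sum.distrib[symmetric] by (intro sum.cong refl) (auto simp: c'_def const_add distrib_right)
    also have "(\<Sum>\<kappa>\<in>insert \<nu> F. if \<kappa> \<in> F then const (c \<kappa>) * schur \<kappa> else 0) = Q"
      unfolding F(3) using F(1) by (intro sum.mono_neutral_cong_right) auto
    also have "(\<Sum>\<kappa>\<in>insert \<nu> F. if \<kappa> = \<nu> then const d * schur \<nu> else 0) = const d * schur \<nu>"
      using F(1) by simp
    finally show ?case using F scale_add(1)
      by (intro exI[of _ "insert \<nu> F"] exI[of _ c']) (auto simp: add.commute)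
  qed
  then obtain F c where F: "finite F" "F \<subseteq> Collect is_partition" "P = (\<Sum>\<nu>\<in>F. const (c \<nu>) * schur \<nu>)"
    by blast
  have form_P: "form P (schur \<kappa>) = (if \<kappa> \<in> F then c \<kappa> else 0)" if "is_partition \<kappa>" for \<kappa>
  proof -
    have "form P (schur \<kappa>) = (\<Sum>\<nu>\<in>F. if \<nu> = \<kappa> then c \<kappa> else 0)"
      unfolding F(3) form_sum_left form_scale_left using F(2) that
      by (intro sum.cong refl) (auto simp: form_schur)
    then show ?thesis using F(1) by simp
  qed
  have sub: "{\<nu>. is_partition \<nu> \<and> form P (schur \<nu>) \<noteq> 0} \<subseteq> F"
    using form_P by (auto split: if_splits)
  then show "finite {\<nu>. is_partition \<nu> \<and> form P (schur \<nu>) \<noteq> 0}"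
    using F(1) finite_subset by blast
  have "(\<Sum>\<nu> | is_partition \<nu> \<and> form P (schur \<nu>) \<noteq> 0. const (form P (schur \<nu>)) * schur \<nu>) =
    (\<Sum>\<nu>\<in>F. const (c \<nu>) * schur \<nu>)"
    using F(1,2) sub form_P by (intro sum.mono_neutral_cong_left) auto
  then show "P = (\<Sum>\<nu> | is_partition \<nu> \<and> form P (schur \<nu>) \<noteq> 0. const (form P (schur \<nu>)) * schur \<nu>)"
    using F(3) by simp
qed

text \<open>\<open>Omega_perp fv\<close> inverts \<open>Omega_perp (- fv)\<close> and so turns an
  expansion in \<open>schur_v\<close> into a Schur expansion, whose coefficients orthonormality
  reads off.\<close>

lemma basis_coeffs_schur_v:
  "basis_coeffs schur_v P \<nu> = (if is_partition \<nu> then form (Omega_perp fv P) (schur \<nu>) else 0)"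
proof -
  let ?E = "Omega_perp (- fv)" and ?E' = "Omega_perp fv"
  note E = domino_skewD(1)[OF domino_skew_minus_fv] and E' = domino_skewD(1)[OF domino_skew_fv]
  have EE': "?E (?E' Q) = Q" for Q
    by (rule domino_skew_inverse[OF domino_skew_minus_fv domino_skew_fv]) simp
  have E'E: "?E' (?E Q) = Q" for Q
    by (rule domino_skew_inverse[OF domino_skew_fv domino_skew_minus_fv]) simp
  define c0 where "c0 \<nu> = (if is_partition \<nu> then form (?E' P) (schur \<nu>) else 0)" for \<nu>
  have c0_set: "{\<nu>. c0 \<nu> \<noteq> 0} = {\<nu>. is_partition \<nu> \<and> form (?E' P) (schur \<nu>) \<noteq> 0}"
    by (auto simp: c0_def)
  have "basis_coeffs schur_v P = c0"
    unfolding basis_coeffs_def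
  proof (rule the_equality, intro conjI)
    show "finite {\<nu>. c0 \<nu> \<noteq> 0}" unfolding c0_set by (rule schur_expansion)
    show "{\<nu>. c0 \<nu> \<noteq> 0} \<subseteq> Collect is_partition" by (auto simp: c0_def)
    have "?E' P = (\<Sum>\<nu> | c0 \<nu> \<noteq> 0. const (c0 \<nu>) * schur \<nu>)"
      unfolding c0_set by (subst schur_expansion(2)[of "?E' P"]) (simp add: c0_def)
    then have "?E (?E' P) = (\<Sum>\<nu> | c0 \<nu> \<noteq> 0. scale (c0 \<nu>) (schur_v \<nu>))"
      by (simp add: slinear_sum[OF E] slinear_scale[OF E] scale_def schur_v_def)
    then show "P = (\<Sum>\<nu> | c0 \<nu> \<noteq> 0. scale (c0 \<nu>) (schur_v \<nu>))" by (simp add: EE')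
  next
    fix c
    assume c: "finite {\<nu>. c \<nu> \<noteq> 0} \<and> {\<nu>. c \<nu> \<noteq> 0} \<subseteq> Collect is_partition \<and>
      P = (\<Sum>\<nu> | c \<nu> \<noteq> 0. scale (c \<nu>) (schur_v \<nu>))"
    then have "?E' P = ?E' (\<Sum>\<nu> | c \<nu> \<noteq> 0. scale (c \<nu>) (schur_v \<nu>))" by simp
    then have E'P: "?E' P = (\<Sum>\<nu> | c \<nu> \<noteq> 0. const (c \<nu>) * schur \<nu>)"
      by (simp add: slinear_sum[OF E'] slinear_scale[OF E'] scale_def schur_v_def E'E)
    show "c = c0"
    proof
      fix \<kappa>
      show "c \<kappa> = c0 \<kappa>"
      proof (cases "is_partition \<kappa>")
        case True
        have "form (?E' P) (schur \<kappa>) = (\<Sum>\<nu> | c \<nu> \<noteq> 0. if \<nu> = \<kappa> then c \<kappa> else 0)"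
          unfolding E'P form_sum_left form_scale_left using c True
          by (intro sum.cong refl) (auto simp: form_schur)
        also have "\<dots> = c \<kappa>" using c by simp
        finally show ?thesis using True by (simp add: c0_def)
      next
        case False
        then show ?thesis using c by (auto simp: c0_def)
      qed
    qed
  qed
  then show ?thesis by (simp add: c0_def)
qed

lemma basis_coeffs_schur_v_t_to_t2:
  "basis_coeffs schur_v (t_to_t2 P) \<nu> = sq_subst (basis_coeffs schur_v P \<nu>)"
  using form_t_to_t2[of "Omega_perp fv P" "schur \<nu>"]
  by (simp add: basis_coeffs_schur_v t_to_t2_schur t_to_t2_Omega_perp_fv)

section \<open>Comparison of the two creation families\<close>

lemma HH_eq: "HH \<mu> = t_to_t2 (BB \<mu>)"
proof -
  have fam_v: "creation_family (\<lambda>_. - 1) (\<lambda>_. 1) bernstein_v"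
    unfolding bernstein_v_def[abs_def]
    by (rule creation_family_conj[OF creation_family_bernstein domino_skew_minus_fv domino_skew_fv]) simp
  note B = creation_family_analogue[OF fam_v, of tvar]
  \<comment> \<open>The analogue keeps the first parameter 0, and the conjugation inserts t^(2n) -
    1. This is the image of -(1 - t^n), the first parameter in \<open>B\<close>, under the
    substitution.\<close>
  have "creation_family (\<lambda>n. (tvar\<^sup>2) ^ n - 1) (\<lambda>n. (1 - coeff_adams n (tvar\<^sup>2)) * 1) H_op"
    unfolding H_op_def[abs_def]
    using creation_family_analogue[OF creation_family_bernstein, of "tvar\<^sup>2"]
    by (intro creation_family_conj[OF _ domino_skew_fv_t_diff domino_skew_fv_diff_t]) simp_all
  note t_to_t2_creation_family[OF B this]
  moreover have "sq_subst tvar = tvar\<^sup>2"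
    by (simp add: sq_subst_def tvar_def pcompose_pCons)
  ultimately have "t_to_t2 (analogue tvar (bernstein_v r) P) = H_op r (t_to_t2 P)" for r P
    by (simp add: coeff_adams_tvar sq.hom_mult sq.hom_minus sq.hom_power sq.hom_uminus power_mult[symmetric] mult.commute)
  then show ?thesis
    by (induction \<mu>) (simp_all add: HH_def BB_def)
qed

theorem proposition31:
  fixes \<mu> :: "nat list"
  assumes "is_partition \<mu>"
  shows "HH \<mu> = t_to_t2 (BB \<mu>) \<and>
    (\<forall>\<nu>. is_partition \<nu> \<longrightarrow> K_coeff \<nu> \<mu> = pcompose (d_coeff \<nu> \<mu>) (tvar\<^sup>2))"
  by (simp add: HH_eq K_coeff_def d_coeff_def basis_coeffs_schur_v_t_to_t2 sq_subst_def)

end
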